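(* Let $\mathfrak g=\mathfrak r\oplus\mathfrak s$ be an orthogonal decomposition with respect to the Killing form $B$, with $\mathfrak r$ a reductive subalgebra (to which $B$ restricts nondegenerately) and $\mathfrak s$ even-dimensional. Let $0\to X\xrightarrow{i}Y\xrightarrow{p}Z\to0$ be a short exact sequence of $(\mathfrak g,K)$-modules and assume that the square of the Dirac operator $D=D(\mathfrak g,\mathfrak r)$ is a semisimple (diagonalizable) operator on each of $X\otimes S$, $Y\otimes S$ and $Z\otimes S$. Then there is a six-term exact sequence (exact cyclically at all six terms) $$H_D^0(X)\to H_D^0(Y)\to H_D^0(Z)\xrightarrow{\ \partial\ }H_D^1(X)\to H_D^1(Y)\to H_D^1(Z)\xrightarrow{\ \partial\ }H_D^0(X),$$ where the maps other than $\partial$ are induced by $i$ and $p$ (tensored with the identity of $S$), and the connecting homomorphisms $\partial$ are defined as follows: for a class represented by $z\in Z\otimes S$ with $Dz=0$, choose $y\in Y\otimes S$ of the same parity with $py=z$ and $D^2y=0$; then $Dy=ix$ for a unique $x\in X\otimes S$, which satisfies $Dx=0$, and $\partial[z]=[x]$.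
   Context: $\mathfrak g$ is the complexified Lie algebra of a connected semisimple Lie group $G$ with finite center and maximal compact subgroup $K$; $B$ is the Killing form. $C(\mathfrak s)$ is the Clifford algebra of $(\mathfrak s,B)$ with relations $vw+wv=2B(v,w)$. With $Z_i$ a $B$-orthonormal basis of $\mathfrak s$, Kostant's cubic Dirac operator is $$D(\mathfrak g,\mathfrak r)=\sum_iZ_i\otimes Z_i-\tfrac12\sum_{i<j<k}B([Z_i,Z_j],Z_k)\otimes Z_iZ_jZ_k\in U(\mathfrak g)\otimes C(\mathfrak s).$$ $S$ is the spin module of $C(\mathfrak s)$ (the unique simple module, as $\dim\mathfrak s$ is even), with its $\mathbb Z_2$-grading $S=S^0\oplus S^1$ for which elements of $\mathfrak s$ act as odd operators. For a $(\mathfrak g,K)$-module $V$, $D$ acts on $V\otimes S$ as an odd operator for the grading $V\otimes S=V\otimes S^0\oplus V\otimes S^1$. The Dirac cohomology $H_D(V)=\operatorname{Ker}D/(\operatorname{Im}D\cap\operatorname{Ker}D)$ is therefore $\mathbb Z_2$-graded, $H_D(V)=H_D^0(V)\oplus H_D^1(V)$. *)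

theory Defs
  imports "HOL-Analysis.Analysis" "HOL-Library.Poly_Mapping" "HOL-Library.Z2"
begin

section \<open>Complex vector spaces\<close>

class complex_vector = ab_group_add +
  fixes scaleC :: "complex \<Rightarrow> 'a \<Rightarrow> 'a" (infixr "*\<^sub>C" 75)
  assumes scaleC_add_right: "a *\<^sub>C (x + y) = a *\<^sub>C x + a *\<^sub>C y"
    and scaleC_add_left: "(a + b) *\<^sub>C x = a *\<^sub>C x + b *\<^sub>C x"
    and scaleC_scaleC: "a *\<^sub>C (b *\<^sub>C x) = (a * b) *\<^sub>C x"
    and scaleC_one: "1 *\<^sub>C x = x"

global_interpretation complex_vector: vector_space "scaleC :: complex \<Rightarrow> 'a \<Rightarrow> 'a :: complex_vector"
  defines cspan = complex_vector.span
    and csubspace = complex_vector.subspace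
    and cdependent = complex_vector.dependent
    and crepresentation = complex_vector.representation
    and cextend_basis = complex_vector.extend_basis
    and cdim = complex_vector.dim
  by unfold_locales (auto simp: scaleC_add_right scaleC_add_left scaleC_scaleC scaleC_one)

abbreviation clinear :: "('a::complex_vector \<Rightarrow> 'b::complex_vector) \<Rightarrow> bool"
  where "clinear \<equiv> Vector_Spaces.linear scaleC scaleC"

instantiation complex :: complex_vector
begin
definition "scaleC_complex = (\<lambda>a b :: complex. a * b)"
instance by standard (auto simp: scaleC_complex_def algebra_simps)
end

instantiation poly_mapping :: (type, complex_vector) complex_vector
begin
definition "scaleC_poly_mapping = (\<lambda>a. Poly_Mapping.map (scaleC a) :: ('a \<Rightarrow>\<^sub>0 'b) \<Rightarrow> _)"

lemma lookup_scaleC: "Poly_Mapping.lookup (a *\<^sub>C p) k = a *\<^sub>C Poly_Mapping.lookup p k"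
  for p :: "'a \<Rightarrow>\<^sub>0 'b"
  by (simp add: scaleC_poly_mapping_def Poly_Mapping.map.rep_eq when_def)

instance
  by standard (auto intro!: poly_mapping_eqI
      simp: lookup_scaleC lookup_add scaleC_add_right scaleC_add_left scaleC_scaleC scaleC_one)
end

lemma scaleC_conv_mult: "a *\<^sub>C p = Poly_Mapping.single 0 a * p"
  for p :: "'a::monoid_add \<Rightarrow>\<^sub>0 complex"
  by (simp add: scaleC_poly_mapping_def scaleC_complex_def[abs_def] mult_map_scale_conv_mult)

lemma scaleC_conv_mult_right: "a *\<^sub>C p = p * Poly_Mapping.single 0 a"
  for p :: "'a::monoid_add \<Rightarrow>\<^sub>0 complex"
proof -
  have "Poly_Mapping.single 0 a * p = p * Poly_Mapping.single 0 a"
  proof (induction p rule: update_induct)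
    case (update p k v)
    have "Poly_Mapping.update k v p = p + Poly_Mapping.single k v"
      using update.hyps(1) by (intro poly_mapping_eqI)
        (auto simp: lookup_update lookup_add lookup_single when_def not_in_keys_iff_lookup_eq_zero)
    with update.IH show ?case by (simp add: distrib_left distrib_right mult_single mult.commute)
  qed simp
  then show ?thesis by (simp add: scaleC_conv_mult)
qed

definition finite_dim_subspace :: "'a::complex_vector set \<Rightarrow> bool"
  where "finite_dim_subspace W \<longleftrightarrow> (\<exists>b. finite b \<and> cspan b = W)"

text \<open>The trace is only meaningful on finite-dimensional spaces.\<close>

definition ctrace :: "('a::complex_vector \<Rightarrow> 'a) \<Rightarrow> complex"
  where "ctrace f = (let b = cextend_basis {} in \<Sum>v\<in>b. crepresentation b (f v) v)"

definition diagonalizable :: "('a::complex_vector \<Rightarrow> 'a) \<Rightarrow> bool"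
  where "diagonalizable T \<longleftrightarrow> cspan {w. \<exists>c. T w = c *\<^sub>C w} = UNIV"

definition direct_sum :: "'a::complex_vector set \<Rightarrow> 'a set \<Rightarrow> 'a set \<Rightarrow> bool"
  where "direct_sum W U V \<longleftrightarrow> csubspace U \<and> csubspace V \<and> U \<inter> V = {0}
    \<and> W = {u + v | u v. u \<in> U \<and> v \<in> V}"

class complex_algebra = complex_vector + ring + monoid_mult +
  assumes mult_scaleC_left: "(a *\<^sub>C x) * y = a *\<^sub>C (x * y)"
    and mult_scaleC_right: "x * (a *\<^sub>C y) = a *\<^sub>C (x * y)"


section \<open>Tensor products\<close>

definition formal_tensor :: "'a::complex_vector \<Rightarrow> 'b::complex_vector \<Rightarrow> 'a \<times> 'b \<Rightarrow>\<^sub>0 complex"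
  where "formal_tensor a b = Poly_Mapping.single (a, b) 1"

inductive_set tensor_relations :: "('a::complex_vector \<times> 'b::complex_vector \<Rightarrow>\<^sub>0 complex) set" where
  "formal_tensor (a + a') b - formal_tensor a b - formal_tensor a' b \<in> tensor_relations"
| "formal_tensor a (b + b') - formal_tensor a b - formal_tensor a b' \<in> tensor_relations"
| "formal_tensor (c *\<^sub>C a) b - c *\<^sub>C formal_tensor a b \<in> tensor_relations"
| "formal_tensor a (c *\<^sub>C b) - c *\<^sub>C formal_tensor a b \<in> tensor_relations"

definition tensor_equiv ::
    "('a::complex_vector \<times> 'b::complex_vector \<Rightarrow>\<^sub>0 complex) \<Rightarrow> ('a \<times> 'b \<Rightarrow>\<^sub>0 complex) \<Rightarrow> bool"
  where "tensor_equiv p q \<longleftrightarrow> p - q \<in> cspan tensor_relations"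

lemma equivp_diff_in_subspace:
  assumes "csubspace N" shows "equivp (\<lambda>p q. p - q \<in> N)"
proof (rule equivpI)
  show "reflp (\<lambda>p q. p - q \<in> N)"
    using assms by (simp add: reflp_def complex_vector.subspace_0)
  show "symp (\<lambda>p q. p - q \<in> N)"
    using complex_vector.subspace_neg[OF assms] by (force simp: symp_def)
  show "transp (\<lambda>p q. p - q \<in> N)"
    using complex_vector.subspace_add[OF assms]
    by (auto simp: transp_def) (metis add_diff_eq diff_add_cancel)
qed

lemma diff_in_subspace_cong:
  assumes S: "csubspace N" and "p - p' \<in> N" "q - q' \<in> N"
  shows "(p + q) - (p' + q') \<in> N" "(p - q) - (p' - q') \<in> N"
    "(- p) - (- p') \<in> N" "c *\<^sub>C p - c *\<^sub>C p' \<in> N"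
proof -
  show "(p + q) - (p' + q') \<in> N"
    using complex_vector.subspace_add[OF assms] by (simp add: algebra_simps)
  show "(p - q) - (p' - q') \<in> N"
    using complex_vector.subspace_diff[OF assms] by (simp add: algebra_simps)
  show "(- p) - (- p') \<in> N"
    using complex_vector.subspace_neg[OF assms(1,2)] by (simp add: algebra_simps)
  show "c *\<^sub>C p - c *\<^sub>C p' \<in> N"
    using complex_vector.subspace_scale[OF assms(1,2), of c]
    by (simp add: complex_vector.scale_right_diff_distrib)
qed

lemma equivp_tensor_equiv: "equivp tensor_equiv"
  unfolding tensor_equiv_def[abs_def] by (rule equivp_diff_in_subspace) simp

quotient_type (overloaded) ('a, 'b) tensor =
  "('a::complex_vector \<times> 'b::complex_vector) \<Rightarrow>\<^sub>0 complex" / tensor_equiv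
  by (rule equivp_tensor_equiv)

instantiation tensor :: (complex_vector, complex_vector) complex_vector
begin
lift_definition zero_tensor :: "('a, 'b) tensor" is 0 .
lift_definition plus_tensor :: "('a, 'b) tensor \<Rightarrow> ('a, 'b) tensor \<Rightarrow> ('a, 'b) tensor" is "(+)"
  unfolding tensor_equiv_def by (rule diff_in_subspace_cong) auto
lift_definition uminus_tensor :: "('a, 'b) tensor \<Rightarrow> ('a, 'b) tensor" is uminus
  unfolding tensor_equiv_def by (rule diff_in_subspace_cong) auto
lift_definition minus_tensor :: "('a, 'b) tensor \<Rightarrow> ('a, 'b) tensor \<Rightarrow> ('a, 'b) tensor" is "(-)"
  unfolding tensor_equiv_def by (rule diff_in_subspace_cong) auto
lift_definition scaleC_tensor :: "complex \<Rightarrow> ('a, 'b) tensor \<Rightarrow> ('a, 'b) tensor" is scaleC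
  unfolding tensor_equiv_def by (rule diff_in_subspace_cong) auto
instance
  by standard (transfer, simp add: tensor_equiv_def algebra_simps
      scaleC_add_right scaleC_add_left scaleC_scaleC scaleC_one complex_vector.span_zero)+
end

lift_definition tensor_prod :: "'a::complex_vector \<Rightarrow> 'b::complex_vector \<Rightarrow> ('a, 'b) tensor" (infixr "\<otimes>\<^sub>C" 70)
  is formal_tensor .

text \<open>The linear map induced by a bilinear map \<open>f\<close>: a representative is evaluated, and bilinearity of
  \<open>f\<close> makes the value independent of its choice.\<close>

definition tensor_lift :: "('a::complex_vector \<Rightarrow> 'b::complex_vector \<Rightarrow> 'c::complex_vector) \<Rightarrow> ('a, 'b) tensor \<Rightarrow> 'c"
  where "tensor_lift f t = (let p = rep_tensor t in
    \<Sum>k\<in>Poly_Mapping.keys p. Poly_Mapping.lookup p k *\<^sub>C f (fst k) (snd k))"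

definition tensor_map :: "('a::complex_vector \<Rightarrow> 'c::complex_vector) \<Rightarrow> ('b::complex_vector \<Rightarrow> 'd::complex_vector)
    \<Rightarrow> ('a, 'b) tensor \<Rightarrow> ('c, 'd) tensor"
  where "tensor_map f g = tensor_lift (\<lambda>a b. f a \<otimes>\<^sub>C g b)"

text \<open>Given actions of \<open>A\<close> on \<open>V\<close> and of \<open>C\<close> on \<open>S\<close>, the action of \<open>A \<otimes> C\<close> on \<open>V \<otimes> S\<close>,
  \<open>(a \<otimes> c)(v \<otimes> s) = av \<otimes> cs\<close>.\<close>

definition tensor_act :: "('a::complex_vector \<Rightarrow> 'v::complex_vector \<Rightarrow> 'v)
    \<Rightarrow> ('c::complex_vector \<Rightarrow> 's::complex_vector \<Rightarrow> 's) \<Rightarrow> ('a, 'c) tensor \<Rightarrow> ('v, 's) tensor \<Rightarrow> ('v, 's) tensor"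
  where "tensor_act \<rho> \<sigma> t w = tensor_lift (\<lambda>a c. tensor_map (\<rho> a) (\<sigma> c) w) t"

text \<open>The image of \<open>V \<otimes> E\<close> in \<open>V \<otimes> S\<close>, for a subspace \<open>E\<close> of \<open>S\<close>.\<close>

definition tensor_part :: "'s::complex_vector set \<Rightarrow> ('v::complex_vector, 's) tensor set"
  where "tensor_part E = cspan {v \<otimes>\<^sub>C m | v m. m \<in> E}"


section \<open>Free algebras and two-sided ideals\<close>

text \<open>Noncommutative polynomials in the elements of a set are finitely supported functions on words,
  multiplied by convolution.\<close>

datatype 'a word = Word (letters: "'a list")

instantiation word :: (type) monoid_add
begin
definition "0 = Word []"
definition "u + v = Word (letters u @ letters v)"
instance by standard (auto simp: zero_word_def plus_word_def)
end

type_synonym 'a free_algebra = "'a word \<Rightarrow>\<^sub>0 complex"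

definition gen :: "'a \<Rightarrow> 'a free_algebra"
  where "gen x = Poly_Mapping.single (Word [x]) 1"

inductive_set two_sided_ideal :: "'a::ring_1 set \<Rightarrow> 'a set" for R where
  zero: "0 \<in> two_sided_ideal R"
| step: "\<lbrakk>r \<in> R; z \<in> two_sided_ideal R\<rbrakk> \<Longrightarrow> x * r * y + z \<in> two_sided_ideal R"

lemma two_sided_ideal_add: "z \<in> two_sided_ideal R \<Longrightarrow> z' \<in> two_sided_ideal R \<Longrightarrow> z + z' \<in> two_sided_ideal R"
  by (induction rule: two_sided_ideal.induct) (auto simp: add.assoc intro: two_sided_ideal.intros)

lemma two_sided_ideal_mult: "z \<in> two_sided_ideal R \<Longrightarrow> a * z * b \<in> two_sided_ideal R"
proof (induction rule: two_sided_ideal.induct)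
  case (step r z x y)
  have "a * (x * r * y + z) * b = (a * x) * r * (y * b) + a * z * b"
    by (simp add: algebra_simps)
  with step show ?case by (metis two_sided_ideal.step)
qed (auto intro: two_sided_ideal.zero)

lemma two_sided_ideal_mult_left: "z \<in> two_sided_ideal R \<Longrightarrow> a * z \<in> two_sided_ideal R"
  using two_sided_ideal_mult[of z R a 1] by simp

lemma two_sided_ideal_mult_right: "z \<in> two_sided_ideal R \<Longrightarrow> z * b \<in> two_sided_ideal R"
  using two_sided_ideal_mult[of z R 1 b] by simp

lemma csubspace_two_sided_ideal: "csubspace (two_sided_ideal R)" for R :: "'a free_algebra set"
  by (auto simp: complex_vector.subspace_def scaleC_conv_mult
      intro: two_sided_ideal.zero two_sided_ideal_add two_sided_ideal_mult_left)

lemma two_sided_ideal_mult_cong: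
  assumes "p - p' \<in> two_sided_ideal R" "q - q' \<in> two_sided_ideal R"
  shows "p * q - p' * q' \<in> two_sided_ideal R"
proof -
  have "p * q - p' * q' = (p - p') * q + p' * (q - q')" by (simp add: algebra_simps)
  with assms show ?thesis
    by (metis two_sided_ideal_add two_sided_ideal_mult_left two_sided_ideal_mult_right)
qed

text \<open>Together with these relations the free algebra on the set \<open>V\<close> presents the tensor algebra of
  the vector space \<open>V\<close>.\<close>

inductive_set linearity_relations :: "'a::complex_vector free_algebra set" where
  "gen (x + y) - gen x - gen y \<in> linearity_relations"
| "gen (c *\<^sub>C x) - c *\<^sub>C gen x \<in> linearity_relations"


section \<open>Lie algebras and universal enveloping algebras\<close>

class complex_lie_algebra = complex_vector +
  fixes lie_bracket :: "'a \<Rightarrow> 'a \<Rightarrow> 'a" ("\<lbrakk>_, _\<rbrakk>\<^sub>L")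
  assumes lie_add_left: "\<lbrakk>x + y, z\<rbrakk>\<^sub>L = \<lbrakk>x, z\<rbrakk>\<^sub>L + \<lbrakk>y, z\<rbrakk>\<^sub>L"
    and lie_add_right: "\<lbrakk>x, y + z\<rbrakk>\<^sub>L = \<lbrakk>x, y\<rbrakk>\<^sub>L + \<lbrakk>x, z\<rbrakk>\<^sub>L"
    and lie_scale_left: "\<lbrakk>c *\<^sub>C x, y\<rbrakk>\<^sub>L = c *\<^sub>C \<lbrakk>x, y\<rbrakk>\<^sub>L"
    and lie_scale_right: "\<lbrakk>x, c *\<^sub>C y\<rbrakk>\<^sub>L = c *\<^sub>C \<lbrakk>x, y\<rbrakk>\<^sub>L"
    and lie_self: "\<lbrakk>x, x\<rbrakk>\<^sub>L = 0"
    and lie_jacobi: "\<lbrakk>x, \<lbrakk>y, z\<rbrakk>\<^sub>L\<rbrakk>\<^sub>L + \<lbrakk>y, \<lbrakk>z, x\<rbrakk>\<^sub>L\<rbrakk>\<^sub>L + \<lbrakk>z, \<lbrakk>x, y\<rbrakk>\<^sub>L\<rbrakk>\<^sub>L = 0"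

definition killing :: "'g::complex_lie_algebra \<Rightarrow> 'g \<Rightarrow> complex"
  where "killing x y = ctrace (\<lambda>z. \<lbrakk>x, \<lbrakk>y, z\<rbrakk>\<^sub>L\<rbrakk>\<^sub>L)"

definition lie_subalgebra :: "'g::complex_lie_algebra set \<Rightarrow> bool"
  where "lie_subalgebra r \<longleftrightarrow> csubspace r \<and> (\<forall>x\<in>r. \<forall>y\<in>r. \<lbrakk>x, y\<rbrakk>\<^sub>L \<in> r)"

definition lie_ideal :: "'g::complex_lie_algebra set \<Rightarrow> 'g set \<Rightarrow> bool"
  where "lie_ideal r a \<longleftrightarrow> csubspace a \<and> a \<subseteq> r \<and> (\<forall>x\<in>r. \<forall>y\<in>a. \<lbrakk>x, y\<rbrakk>\<^sub>L \<in> a)"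

text \<open>A Lie algebra is reductive if every ideal has a complementary ideal.\<close>

definition reductive_subalgebra :: "'g::complex_lie_algebra set \<Rightarrow> bool"
  where "reductive_subalgebra r \<longleftrightarrow> lie_subalgebra r \<and>
    (\<forall>a. lie_ideal r a \<longrightarrow> (\<exists>b. lie_ideal r b \<and> direct_sum r a b))"

definition lie_rep :: "('g::complex_lie_algebra \<Rightarrow> 'v::complex_vector \<Rightarrow> 'v) \<Rightarrow> bool"
  where "lie_rep a \<longleftrightarrow> (\<forall>x. clinear (a x)) \<and> (\<forall>v. clinear (\<lambda>x. a x v)) \<and>
    (\<forall>x y v. a \<lbrakk>x, y\<rbrakk>\<^sub>L v = a x (a y v) - a y (a x v))"

inductive_set uea_relations :: "'g::complex_lie_algebra free_algebra set" where
  "r \<in> linearity_relations \<Longrightarrow> r \<in> uea_relations"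
| "gen x * gen y - gen y * gen x - gen \<lbrakk>x, y\<rbrakk>\<^sub>L \<in> uea_relations"

definition uea_equiv :: "'g::complex_lie_algebra free_algebra \<Rightarrow> 'g free_algebra \<Rightarrow> bool"
  where "uea_equiv p q \<longleftrightarrow> p - q \<in> two_sided_ideal uea_relations"

lemma uea_equiv_refl: "uea_equiv p p"
  by (simp add: uea_equiv_def two_sided_ideal.zero)

quotient_type (overloaded) 'g uea = "'g::complex_lie_algebra free_algebra" / uea_equiv
  unfolding uea_equiv_def[abs_def]
  by (rule equivp_diff_in_subspace) (rule csubspace_two_sided_ideal)

instantiation uea :: (complex_lie_algebra) complex_algebra
begin
lift_definition zero_uea :: "'a uea" is 0 .
lift_definition one_uea :: "'a uea" is 1 .
lift_definition plus_uea :: "'a uea \<Rightarrow> 'a uea \<Rightarrow> 'a uea" is "(+)"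
  unfolding uea_equiv_def by (rule diff_in_subspace_cong[OF csubspace_two_sided_ideal])
lift_definition uminus_uea :: "'a uea \<Rightarrow> 'a uea" is uminus
  unfolding uea_equiv_def by (rule diff_in_subspace_cong[OF csubspace_two_sided_ideal])
lift_definition minus_uea :: "'a uea \<Rightarrow> 'a uea \<Rightarrow> 'a uea" is "(-)"
  unfolding uea_equiv_def by (rule diff_in_subspace_cong[OF csubspace_two_sided_ideal])
lift_definition times_uea :: "'a uea \<Rightarrow> 'a uea \<Rightarrow> 'a uea" is "(*)"
  unfolding uea_equiv_def by (rule two_sided_ideal_mult_cong)
lift_definition scaleC_uea :: "complex \<Rightarrow> 'a uea \<Rightarrow> 'a uea" is scaleC
  unfolding uea_equiv_def by (rule diff_in_subspace_cong[OF csubspace_two_sided_ideal])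
instance
proof
  fix x y z :: "'a uea" and a b :: complex
  show "x + y + z = x + (y + z)" by transfer (simp add: uea_equiv_refl add.assoc)
  show "x + y = y + x" by transfer (simp add: uea_equiv_refl add.commute)
  show "0 + x = x" by transfer (simp add: uea_equiv_refl)
  show "- x + x = 0" by transfer (simp add: uea_equiv_refl)
  show "x - y = x + - y" by transfer (simp add: uea_equiv_refl)
  show "a *\<^sub>C (x + y) = a *\<^sub>C x + a *\<^sub>C y" by transfer (simp add: uea_equiv_refl scaleC_add_right)
  show "(a + b) *\<^sub>C x = a *\<^sub>C x + b *\<^sub>C x" by transfer (simp add: uea_equiv_refl scaleC_add_left)
  show "a *\<^sub>C (b *\<^sub>C x) = (a * b) *\<^sub>C x" by transfer (simp add: uea_equiv_refl scaleC_scaleC)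
  show "1 *\<^sub>C x = x" by transfer (simp add: uea_equiv_refl scaleC_one)
  show "x * y * z = x * (y * z)" by transfer (simp add: uea_equiv_refl mult.assoc)
  show "(x + y) * z = x * z + y * z" by transfer (simp add: uea_equiv_refl distrib_right)
  show "x * (y + z) = x * y + x * z" by transfer (simp add: uea_equiv_refl distrib_left)
  show "1 * x = x" by transfer (simp add: uea_equiv_refl)
  show "x * 1 = x" by transfer (simp add: uea_equiv_refl)
  show "(a *\<^sub>C x) * y = a *\<^sub>C (x * y)"
    by transfer (simp add: uea_equiv_refl scaleC_conv_mult mult.assoc)
  show "x * (a *\<^sub>C y) = a *\<^sub>C (x * y)"
    by transfer (simp add: uea_equiv_refl scaleC_conv_mult_right mult.assoc)
qed
end

lift_definition uea_gen :: "'g::complex_lie_algebra \<Rightarrow> 'g uea" is gen .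

text \<open>The extension of a Lie algebra representation to the enveloping algebra: words act by
  composition, and for a representation the result does not depend on the representative.\<close>

definition free_algebra_act :: "('g \<Rightarrow> 'v::complex_vector \<Rightarrow> 'v) \<Rightarrow> 'g free_algebra \<Rightarrow> 'v \<Rightarrow> 'v"
  where "free_algebra_act a p v =
    (\<Sum>w\<in>Poly_Mapping.keys p. Poly_Mapping.lookup p w *\<^sub>C foldr a (letters w) v)"

definition uea_act :: "('g::complex_lie_algebra \<Rightarrow> 'v::complex_vector \<Rightarrow> 'v) \<Rightarrow> 'g uea \<Rightarrow> 'v \<Rightarrow> 'v"
  where "uea_act a u = free_algebra_act a (rep_uea u)"


section \<open>Clifford algebras and their modules\<close>

class complex_quadratic_space = complex_vector +
  fixes bform :: "'a \<Rightarrow> 'a \<Rightarrow> complex"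
  assumes bform_add_left: "bform (x + y) z = bform x z + bform y z"
    and bform_scale_left: "bform (c *\<^sub>C x) y = c * bform x y"
    and bform_sym: "bform x y = bform y x"

inductive_set clifford_relations :: "'s::complex_quadratic_space free_algebra set" where
  "r \<in> linearity_relations \<Longrightarrow> r \<in> clifford_relations"
| "gen v * gen w + gen w * gen v - (2 * bform v w) *\<^sub>C 1 \<in> clifford_relations"

definition clifford_equiv :: "'s::complex_quadratic_space free_algebra \<Rightarrow> 's free_algebra \<Rightarrow> bool"
  where "clifford_equiv p q \<longleftrightarrow> p - q \<in> two_sided_ideal clifford_relations"

lemma clifford_equiv_refl: "clifford_equiv p p"
  by (simp add: clifford_equiv_def two_sided_ideal.zero)

quotient_type (overloaded) 's clifford = "'s::complex_quadratic_space free_algebra" / clifford_equiv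
  unfolding clifford_equiv_def[abs_def]
  by (rule equivp_diff_in_subspace) (rule csubspace_two_sided_ideal)

instantiation clifford :: (complex_quadratic_space) complex_algebra
begin
lift_definition zero_clifford :: "'a clifford" is 0 .
lift_definition one_clifford :: "'a clifford" is 1 .
lift_definition plus_clifford :: "'a clifford \<Rightarrow> 'a clifford \<Rightarrow> 'a clifford" is "(+)"
  unfolding clifford_equiv_def by (rule diff_in_subspace_cong[OF csubspace_two_sided_ideal])
lift_definition uminus_clifford :: "'a clifford \<Rightarrow> 'a clifford" is uminus
  unfolding clifford_equiv_def by (rule diff_in_subspace_cong[OF csubspace_two_sided_ideal])
lift_definition minus_clifford :: "'a clifford \<Rightarrow> 'a clifford \<Rightarrow> 'a clifford" is "(-)"
  unfolding clifford_equiv_def by (rule diff_in_subspace_cong[OF csubspace_two_sided_ideal])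
lift_definition times_clifford :: "'a clifford \<Rightarrow> 'a clifford \<Rightarrow> 'a clifford" is "(*)"
  unfolding clifford_equiv_def by (rule two_sided_ideal_mult_cong)
lift_definition scaleC_clifford :: "complex \<Rightarrow> 'a clifford \<Rightarrow> 'a clifford" is scaleC
  unfolding clifford_equiv_def by (rule diff_in_subspace_cong[OF csubspace_two_sided_ideal])
instance
proof
  fix x y z :: "'a clifford" and a b :: complex
  show "x + y + z = x + (y + z)" by transfer (simp add: clifford_equiv_refl add.assoc)
  show "x + y = y + x" by transfer (simp add: clifford_equiv_refl add.commute)
  show "0 + x = x" by transfer (simp add: clifford_equiv_refl)
  show "- x + x = 0" by transfer (simp add: clifford_equiv_refl)
  show "x - y = x + - y" by transfer (simp add: clifford_equiv_refl)
  show "a *\<^sub>C (x + y) = a *\<^sub>C x + a *\<^sub>C y" by transfer (simp add: clifford_equiv_refl scaleC_add_right)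
  show "(a + b) *\<^sub>C x = a *\<^sub>C x + b *\<^sub>C x" by transfer (simp add: clifford_equiv_refl scaleC_add_left)
  show "a *\<^sub>C (b *\<^sub>C x) = (a * b) *\<^sub>C x" by transfer (simp add: clifford_equiv_refl scaleC_scaleC)
  show "1 *\<^sub>C x = x" by transfer (simp add: clifford_equiv_refl scaleC_one)
  show "x * y * z = x * (y * z)" by transfer (simp add: clifford_equiv_refl mult.assoc)
  show "(x + y) * z = x * z + y * z" by transfer (simp add: clifford_equiv_refl distrib_right)
  show "x * (y + z) = x * y + x * z" by transfer (simp add: clifford_equiv_refl distrib_left)
  show "1 * x = x" by transfer (simp add: clifford_equiv_refl)
  show "x * 1 = x" by transfer (simp add: clifford_equiv_refl)
  show "(a *\<^sub>C x) * y = a *\<^sub>C (x * y)"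
    by transfer (simp add: clifford_equiv_refl scaleC_conv_mult mult.assoc)
  show "x * (a *\<^sub>C y) = a *\<^sub>C (x * y)"
    by transfer (simp add: clifford_equiv_refl scaleC_conv_mult_right mult.assoc)
qed
end

lift_definition clifford_gen :: "'s::complex_quadratic_space \<Rightarrow> 's clifford" is gen .

definition algebra_module :: "('a::complex_algebra \<Rightarrow> 'm::complex_vector \<Rightarrow> 'm) \<Rightarrow> bool"
  where "algebra_module \<sigma> \<longleftrightarrow> (\<forall>a. clinear (\<sigma> a)) \<and> (\<forall>m. clinear (\<lambda>a. \<sigma> a m)) \<and>
    (\<forall>m. \<sigma> 1 m = m) \<and> (\<forall>a b m. \<sigma> (a * b) m = \<sigma> a (\<sigma> b m))"

definition simple_module :: "('a::complex_algebra \<Rightarrow> 'm::complex_vector \<Rightarrow> 'm) \<Rightarrow> bool"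
  where "simple_module \<sigma> \<longleftrightarrow> algebra_module \<sigma> \<and> (\<exists>m::'m. m \<noteq> 0) \<and>
    (\<forall>W. csubspace W \<and> (\<forall>a. \<forall>m\<in>W. \<sigma> a m \<in> W) \<longrightarrow> W = {0} \<or> W = UNIV)"

text \<open>A \<open>\<int>/2\<close>-grading of a Clifford module for which vectors act as odd operators.\<close>

definition spin_grading :: "('s::complex_quadratic_space clifford \<Rightarrow> 'm::complex_vector \<Rightarrow> 'm) \<Rightarrow> (bit \<Rightarrow> 'm set) \<Rightarrow> bool"
  where "spin_grading \<sigma> P \<longleftrightarrow> direct_sum UNIV (P 0) (P 1) \<and>
    (\<forall>v \<epsilon>. \<forall>m \<in> P \<epsilon>. \<sigma> (clifford_gen v) m \<in> P (\<epsilon> + 1))"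


section \<open>Lie groups and their Lie algebras\<close>

text \<open>Groups are written additively although they need not be commutative, as in the library class
  \<open>topological_group_add\<close>.\<close>

primrec Ck_on :: "nat \<Rightarrow> ('a::real_normed_vector \<Rightarrow> 'b::real_normed_vector) \<Rightarrow> 'a set \<Rightarrow> bool" where
  "Ck_on 0 f U \<longleftrightarrow> continuous_on U f"
| "Ck_on (Suc k) f U \<longleftrightarrow> (\<forall>x\<in>U. f differentiable (at x)) \<and>
     (\<forall>v. Ck_on k (\<lambda>x. frechet_derivative f (at x) v) U)"

definition smooth_on :: "'a::real_normed_vector set \<Rightarrow> ('a \<Rightarrow> 'b::real_normed_vector) \<Rightarrow> bool"
  where "smooth_on U f \<longleftrightarrow> (\<forall>k. Ck_on k f U)"

text \<open>A chart is a pair of an open set and a function whose values outside this set are irrelevant.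
  The model space is only required to be a finite-dimensional normed space, and not of class
  \<open>euclidean_space\<close>, in order to admit dimension \<open>0\<close>.\<close>

type_synonym ('G, 'e) chart = "'G set \<times> ('G \<Rightarrow> 'e)"

definition is_chart :: "('G::topological_space, 'e::real_normed_vector) chart \<Rightarrow> bool"
  where "is_chart = (\<lambda>(U, f). open U \<and> open (f ` U) \<and> homeomorphism U (f ` U) f (inv_into U f))"

definition smooth_atlas :: "('G::{t2_space, second_countable_topology}, 'e::real_normed_vector) chart set \<Rightarrow> bool"
  where "smooth_atlas \<A> \<longleftrightarrow> (\<exists>b::'e set. finite b \<and> span b = UNIV) \<and>
    (\<forall>c\<in>\<A>. is_chart c) \<and> (\<Union>c\<in>\<A>. fst c) = UNIV \<and>
    (\<forall>(U, f)\<in>\<A>. \<forall>(V, h)\<in>\<A>. smooth_on (f ` (U \<inter> V)) (h \<circ> inv_into U f))"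

definition lie_group ::
    "('G::{topological_group_add, t2_space, second_countable_topology}, 'e::real_normed_vector) chart set \<Rightarrow> bool"
  where "lie_group \<A> \<longleftrightarrow> smooth_atlas \<A> \<and>
    (\<forall>(U, f)\<in>\<A>. \<forall>(V, h)\<in>\<A>. \<forall>(W, k)\<in>\<A>.
      smooth_on {(a, b). a \<in> f ` U \<and> b \<in> h ` V \<and> inv_into U f a + inv_into V h b \<in> W}
        (\<lambda>(a, b). k (inv_into U f a + inv_into V h b))) \<and>
    (\<forall>(U, f)\<in>\<A>. \<forall>(V, h)\<in>\<A>.
      smooth_on {a \<in> f ` U. - inv_into U f a \<in> V} (\<lambda>a. h (- inv_into U f a)))"

definition smooth_functions :: "('G, 'e::real_normed_vector) chart set \<Rightarrow> ('G \<Rightarrow> real) set"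
  where "smooth_functions \<A> = {f. \<forall>(U, h)\<in>\<A>. smooth_on (h ` U) (f \<circ> inv_into U h)}"

text \<open>The Lie algebra of a Lie group: left-invariant vector fields, as derivations of the algebra of
  smooth functions, with the commutator as bracket. They are extended by \<open>0\<close> to functions that are not
  smooth, so that distinct fields are distinct as functions.\<close>

type_synonym 'G field = "('G \<Rightarrow> real) \<Rightarrow> 'G \<Rightarrow> real"

definition left_invariant_fields :: "('G::group_add, 'e::real_normed_vector) chart set \<Rightarrow> 'G field set"
  where "left_invariant_fields \<A> = {X.
    (\<forall>f\<in>smooth_functions \<A>. X f \<in> smooth_functions \<A>) \<and>
    (\<forall>f. f \<notin> smooth_functions \<A> \<longrightarrow> X f = (\<lambda>x. 0)) \<and>
    (\<forall>f\<in>smooth_functions \<A>. \<forall>h\<in>smooth_functions \<A>.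
       X (\<lambda>x. f x + h x) = (\<lambda>x. X f x + X h x) \<and>
       X (\<lambda>x. f x * h x) = (\<lambda>x. f x * X h x + h x * X f x)) \<and>
    (\<forall>f\<in>smooth_functions \<A>. \<forall>c. X (\<lambda>x. c * f x) = (\<lambda>x. c * X f x)) \<and>
    (\<forall>f\<in>smooth_functions \<A>. \<forall>g. X (\<lambda>x. f (g + x)) = (\<lambda>x. X f (g + x)))}"

definition field_zero :: "'G field"
  where "field_zero = (\<lambda>f x. 0)"

definition field_add :: "'G field \<Rightarrow> 'G field \<Rightarrow> 'G field"
  where "field_add X Y = (\<lambda>f x. X f x + Y f x)"

definition field_scale :: "real \<Rightarrow> 'G field \<Rightarrow> 'G field"
  where "field_scale c X = (\<lambda>f x. c * X f x)"

definition field_bracket :: "'G field \<Rightarrow> 'G field \<Rightarrow> 'G field"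
  where "field_bracket X Y = (\<lambda>f x. X (Y f) x - Y (X f) x)"

text \<open>The adjoint action is the push-forward along \<open>x \<mapsto> g x g\<inverse>\<close>.\<close>

definition Ad :: "'G::group_add \<Rightarrow> 'G field \<Rightarrow> 'G field"
  where "Ad g X = (\<lambda>f x. X (\<lambda>y. f (g + y - g)) (- g + x + g))"

text \<open>\<open>c\<close> is the one-parameter subgroup \<open>t \<mapsto> exp (tX)\<close>: a homomorphism and an integral curve of \<open>X\<close>.\<close>

definition one_parameter_subgroup ::
    "('G::group_add, 'e::real_normed_vector) chart set \<Rightarrow> 'G field \<Rightarrow> (real \<Rightarrow> 'G) \<Rightarrow> bool"
  where "one_parameter_subgroup \<A> X c \<longleftrightarrow> (\<forall>s t. c (s + t) = c s + c t) \<and>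
    (\<forall>f\<in>smooth_functions \<A>. \<forall>t. ((\<lambda>t. f (c t)) has_real_derivative X f (c t)) (at t))"

definition field_ideal :: "('G::group_add, 'e::real_normed_vector) chart set \<Rightarrow> 'G field set \<Rightarrow> bool"
  where "field_ideal \<A> I \<longleftrightarrow> I \<subseteq> left_invariant_fields \<A> \<and> field_zero \<in> I \<and>
    (\<forall>X\<in>I. \<forall>Y\<in>I. field_add X Y \<in> I) \<and> (\<forall>c. \<forall>X\<in>I. field_scale c X \<in> I) \<and>
    (\<forall>X\<in>left_invariant_fields \<A>. \<forall>Y\<in>I. field_bracket X Y \<in> I)"

text \<open>A Lie group is semisimple if its Lie algebra has no nonzero abelian ideal.\<close>

definition semisimple_lie_group ::
    "('G::{topological_group_add, t2_space, second_countable_topology}, 'e::real_normed_vector) chart set \<Rightarrow> bool"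
  where "semisimple_lie_group \<A> \<longleftrightarrow> lie_group \<A> \<and>
    (\<forall>I. field_ideal \<A> I \<and> (\<forall>X\<in>I. \<forall>Y\<in>I. field_bracket X Y = field_zero) \<longrightarrow> I = {field_zero})"

definition group_center :: "'G::group_add set"
  where "group_center = {z. \<forall>g. g + z = z + g}"

definition is_subgroup :: "'G::group_add set \<Rightarrow> bool"
  where "is_subgroup K \<longleftrightarrow> 0 \<in> K \<and> (\<forall>k\<in>K. \<forall>l\<in>K. k + l \<in> K) \<and> (\<forall>k\<in>K. - k \<in> K)"

definition maximal_compact_subgroup :: "'G::topological_group_add set \<Rightarrow> bool"
  where "maximal_compact_subgroup K \<longleftrightarrow> is_subgroup K \<and> compact K \<and>
    (\<forall>L. is_subgroup L \<and> compact L \<and> K \<subseteq> L \<longrightarrow> L = K)"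

text \<open>\<open>\<phi>\<close> exhibits the complex Lie algebra \<open>'g\<close> as the complexification of the Lie algebra of the group:
  it is a homomorphism of real Lie algebras, and \<open>'g = \<phi>(L) \<oplus> \<i> \<phi>(L)\<close>.\<close>

definition complexified_lie_algebra ::
    "('G::group_add, 'e::real_normed_vector) chart set \<Rightarrow> ('G field \<Rightarrow> 'g::complex_lie_algebra) \<Rightarrow> bool"
  where "complexified_lie_algebra \<A> \<phi> \<longleftrightarrow> (let L = left_invariant_fields \<A> in
    (\<forall>X\<in>L. \<forall>Y\<in>L. \<phi> (field_add X Y) = \<phi> X + \<phi> Y \<and> \<phi> (field_bracket X Y) = \<lbrakk>\<phi> X, \<phi> Y\<rbrakk>\<^sub>L) \<and>
    (\<forall>X\<in>L. \<forall>c. \<phi> (field_scale c X) = complex_of_real c *\<^sub>C \<phi> X) \<and>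
    (\<forall>x. \<exists>!(X, Y). X \<in> L \<and> Y \<in> L \<and> x = \<phi> X + \<i> *\<^sub>C \<phi> Y))"

text \<open>The space \<open>V\<close> carries no topology. Since every vector lies in a finite-dimensional \<open>K\<close>-stable
  subspace, continuity and differentiability of orbit maps are expressed by applying all linear
  functionals. Equivariance and compatibility with the differential are stated on the real Lie algebra
  and extend to \<open>'g\<close> by complex linearity.\<close>

locale gK_module =
  fixes \<A> :: "('G::{topological_group_add, t2_space, second_countable_topology}, 'e::real_normed_vector) chart set"
    and K :: "'G set"
    and \<phi> :: "'G field \<Rightarrow> 'g::complex_lie_algebra"
    and act :: "'g \<Rightarrow> 'v::complex_vector \<Rightarrow> 'v"
    and kact :: "'G \<Rightarrow> 'v \<Rightarrow> 'v"
  assumes lie_rep: "lie_rep act"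
    and kact_linear: "k \<in> K \<Longrightarrow> clinear (kact k)"
    and kact_zero: "kact 0 v = v"
    and kact_add: "k \<in> K \<Longrightarrow> l \<in> K \<Longrightarrow> kact (k + l) v = kact k (kact l v)"
    and locally_finite: "\<exists>W. finite_dim_subspace W \<and> v \<in> W \<and> (\<forall>k\<in>K. kact k ` W \<subseteq> W)"
    and continuous: "clinear (\<psi> :: 'v \<Rightarrow> complex) \<Longrightarrow> continuous_on K (\<lambda>k. \<psi> (kact k v))"
    and differential: "X \<in> left_invariant_fields \<A> \<Longrightarrow> one_parameter_subgroup \<A> X c \<Longrightarrow> range c \<subseteq> K
      \<Longrightarrow> clinear (\<psi> :: 'v \<Rightarrow> complex)
      \<Longrightarrow> ((\<lambda>t. \<psi> (kact (c t) v)) has_vector_derivative \<psi> (act (\<phi> X) v)) (at 0)"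
    and equivariant: "k \<in> K \<Longrightarrow> X \<in> left_invariant_fields \<A>
      \<Longrightarrow> kact k (act (\<phi> X) v) = act (\<phi> (Ad k X)) (kact k v)"

definition gK_hom :: "'G set \<Rightarrow> ('g \<Rightarrow> 'v::complex_vector \<Rightarrow> 'v) \<Rightarrow> ('G \<Rightarrow> 'v \<Rightarrow> 'v)
    \<Rightarrow> ('g \<Rightarrow> 'w::complex_vector \<Rightarrow> 'w) \<Rightarrow> ('G \<Rightarrow> 'w \<Rightarrow> 'w) \<Rightarrow> ('v \<Rightarrow> 'w) \<Rightarrow> bool"
  where "gK_hom K act kact act' kact' f \<longleftrightarrow> clinear f \<and> (\<forall>x v. f (act x v) = act' x (f v)) \<and>
    (\<forall>k\<in>K. \<forall>v. f (kact k v) = kact' k (f v))"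


section \<open>The cubic Dirac operator and Dirac cohomology\<close>

definition nondegenerate_on :: "'g::complex_lie_algebra set \<Rightarrow> bool"
  where "nondegenerate_on r \<longleftrightarrow> (\<forall>x\<in>r. (\<forall>y\<in>r. killing x y = 0) \<longrightarrow> x = 0)"

definition orthogonal_decomposition :: "'g::complex_lie_algebra set \<Rightarrow> 'g set \<Rightarrow> bool"
  where "orthogonal_decomposition r s \<longleftrightarrow> direct_sum UNIV r s \<and> (\<forall>x\<in>r. \<forall>y\<in>s. killing x y = 0)"

text \<open>The Clifford algebra is defined for types. \<open>e\<close> identifies a type with the subspace \<open>s\<close>, equipped
  with the restriction of the Killing form.\<close>

definition isometric_onto :: "('s::complex_quadratic_space \<Rightarrow> 'g::complex_lie_algebra) \<Rightarrow> 'g set \<Rightarrow> bool"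
  where "isometric_onto e s \<longleftrightarrow> clinear e \<and> bij_betw e UNIV s \<and> (\<forall>v w. bform v w = killing (e v) (e w))"

definition orthonormal_basis :: "(nat \<Rightarrow> 's::complex_quadratic_space) \<Rightarrow> nat \<Rightarrow> bool"
  where "orthonormal_basis Z n \<longleftrightarrow> cspan (Z ` {..<n}) = UNIV \<and>
    (\<forall>i<n. \<forall>j<n. bform (Z i) (Z j) = (if i = j then 1 else 0))"

definition cubic_dirac :: "('s::complex_quadratic_space \<Rightarrow> 'g::complex_lie_algebra) \<Rightarrow> (nat \<Rightarrow> 's) \<Rightarrow> nat
    \<Rightarrow> ('g uea, 's clifford) tensor"
  where "cubic_dirac e Z n =
    (\<Sum>i<n. uea_gen (e (Z i)) \<otimes>\<^sub>C clifford_gen (Z i))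
    - (1/2) *\<^sub>C (\<Sum>k<n. \<Sum>j<k. \<Sum>i<j. killing \<lbrakk>e (Z i), e (Z j)\<rbrakk>\<^sub>L (e (Z k)) *\<^sub>C
        (1 \<otimes>\<^sub>C (clifford_gen (Z i) * clifford_gen (Z j) * clifford_gen (Z k))))"

definition dirac_operator :: "('s::complex_quadratic_space \<Rightarrow> 'g::complex_lie_algebra) \<Rightarrow> (nat \<Rightarrow> 's) \<Rightarrow> nat
    \<Rightarrow> ('g \<Rightarrow> 'v::complex_vector \<Rightarrow> 'v) \<Rightarrow> ('s clifford \<Rightarrow> 'm::complex_vector \<Rightarrow> 'm)
    \<Rightarrow> ('v, 'm) tensor \<Rightarrow> ('v, 'm) tensor"
  where "dirac_operator e Z n act \<sigma> = tensor_act (uea_act act) \<sigma> (cubic_dirac e Z n)"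

text \<open>Dirac cohomology is the quotient of \<open>Ker D\<close> by \<open>boundaries D\<close>. Its elements are cosets.\<close>

definition cycles :: "('a::complex_vector \<Rightarrow> 'a) \<Rightarrow> 'a set"
  where "cycles D = {x. D x = 0}"

definition boundaries :: "('a::complex_vector \<Rightarrow> 'a) \<Rightarrow> 'a set"
  where "boundaries D = range D \<inter> cycles D"

definition dirac_class :: "('a::complex_vector \<Rightarrow> 'a) \<Rightarrow> 'a \<Rightarrow> 'a set"
  where "dirac_class D x = {x + b | b. b \<in> boundaries D}"

definition dirac_cohomology :: "('a::complex_vector \<Rightarrow> 'a) \<Rightarrow> 'a set set"
  where "dirac_cohomology D = dirac_class D ` cycles D"

definition graded_dirac_cohomology :: "('v::complex_vector, 'm::complex_vector) tensor set
    \<Rightarrow> (('v, 'm) tensor \<Rightarrow> ('v, 'm) tensor) \<Rightarrow> ('v, 'm) tensor set set"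
  where "graded_dirac_cohomology E D = {A \<in> dirac_cohomology D. A \<inter> E \<noteq> {}}"

definition coset_add :: "'a::complex_vector set \<Rightarrow> 'a set \<Rightarrow> 'a set"
  where "coset_add A B = {a + b | a b. a \<in> A \<and> b \<in> B}"

text \<open>The map of cosets modulo \<open>boundaries D'\<close> induced by \<open>T\<close>.\<close>

definition induced_map :: "('b::complex_vector \<Rightarrow> 'b) \<Rightarrow> ('a \<Rightarrow> 'b) \<Rightarrow> 'a set \<Rightarrow> 'b set"
  where "induced_map D' T A = {T a + b | a b. a \<in> A \<and> b \<in> boundaries D'}"

definition coset_scale :: "('a::complex_vector \<Rightarrow> 'a) \<Rightarrow> complex \<Rightarrow> 'a set \<Rightarrow> 'a set"
  where "coset_scale D c = induced_map D (scaleC c)"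

definition cohomology_hom :: "('a::complex_vector \<Rightarrow> 'a) \<Rightarrow> ('b::complex_vector \<Rightarrow> 'b)
    \<Rightarrow> 'a set set \<Rightarrow> 'b set set \<Rightarrow> ('a set \<Rightarrow> 'b set) \<Rightarrow> bool"
  where "cohomology_hom D D' H H' f \<longleftrightarrow> f ` H \<subseteq> H' \<and>
    (\<forall>A\<in>H. \<forall>B\<in>H. f (coset_add A B) = coset_add (f A) (f B)) \<and>
    (\<forall>c. \<forall>A\<in>H. f (coset_scale D c A) = coset_scale D' c (f A))"

text \<open>Exactness of \<open>H \<rightarrow> H' \<rightarrow> H''\<close>; the zero of \<open>H''\<close> is the coset \<open>boundaries D''\<close>.\<close>

definition exact_at :: "('c::complex_vector \<Rightarrow> 'c) \<Rightarrow> 'a set \<Rightarrow> 'b set \<Rightarrow> ('a \<Rightarrow> 'b) \<Rightarrow> ('b \<Rightarrow> 'c set) \<Rightarrow> bool"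
  where "exact_at D'' H H' f g \<longleftrightarrow> f ` H = {A \<in> H'. g A = boundaries D''}"

text \<open>\<open>\<delta>\<close> is the connecting homomorphism on classes of parity \<open>\<epsilon>\<close>: the choices in its description
  are possible, and every choice yields the value of \<open>\<delta>\<close>. The function \<open>E\<^sub>U\<close> (for \<open>U = X, Y, Z\<close>) assigns to
  each parity the homogeneous part of the domain of \<open>D\<^sub>U\<close>.\<close>

definition connecting_map :: "('x::complex_vector \<Rightarrow> 'x) \<Rightarrow> ('y::complex_vector \<Rightarrow> 'y) \<Rightarrow> ('z::complex_vector \<Rightarrow> 'z)
    \<Rightarrow> (bit \<Rightarrow> 'x set) \<Rightarrow> (bit \<Rightarrow> 'y set) \<Rightarrow> (bit \<Rightarrow> 'z set) \<Rightarrow> ('x \<Rightarrow> 'y) \<Rightarrow> ('y \<Rightarrow> 'z) \<Rightarrow> bit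
    \<Rightarrow> ('z set \<Rightarrow> 'x set) \<Rightarrow> bool"
  where "connecting_map D\<^sub>X D\<^sub>Y D\<^sub>Z E\<^sub>X E\<^sub>Y E\<^sub>Z i p \<epsilon> \<delta> \<longleftrightarrow>
    (\<forall>z \<in> cycles D\<^sub>Z \<inter> E\<^sub>Z \<epsilon>.
      (\<exists>y \<in> E\<^sub>Y \<epsilon>. p y = z \<and> D\<^sub>Y (D\<^sub>Y y) = 0) \<and>
      (\<forall>y \<in> E\<^sub>Y \<epsilon>. p y = z \<and> D\<^sub>Y (D\<^sub>Y y) = 0 \<longrightarrow>
        (\<exists>!x. D\<^sub>Y y = i x) \<and>
        (\<forall>x. D\<^sub>Y y = i x \<longrightarrow> D\<^sub>X x = 0 \<and> x \<in> E\<^sub>X (\<epsilon> + 1) \<and> \<delta> (dirac_class D\<^sub>Z z) = dirac_class D\<^sub>X x)))"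

end

theory Submission
  imports Defs
begin

text \<open>The image of \<open>D\<close> meets its kernel in \<open>D (Ker D\<^sup>2)\<close>, and \<open>Ker D\<close> is contained in \<open>Ker D\<^sup>2\<close>. So \<open>H\<^sub>D\<close> is
  the homology of \<open>D\<close> on \<open>Ker D\<^sup>2\<close>, where \<open>D\<close> squares to zero. As \<open>D\<close> is odd, this is a two-periodic
  complex, and the six-term sequence is the long exact homology sequence of
  \<open>0 \<rightarrow> Ker D\<^sub>X\<^sup>2 \<rightarrow> Ker D\<^sub>Y\<^sup>2 \<rightarrow> Ker D\<^sub>Z\<^sup>2 \<rightarrow> 0\<close>, wound up into a hexagon.

  The point is the exactness of this sequence at its right end. A diagonalizable operator splits the
  space into its kernel and its image. A preimage in \<open>Y \<otimes> S\<close> of a vector of \<open>Ker D\<^sub>Z\<^sup>2\<close> can therefore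
  be corrected by an element of the image of \<open>D\<^sub>Y\<^sup>2\<close>, without changing its projection
  (\<open>kernel_lift_of_diagonalizable\<close>).

  The homological part is carried out in the locale \<open>odd_exact_sequence\<close>, for odd operators on
  arbitrary \<open>\<int>/2\<close>-graded complex vector spaces. The connecting map is defined there as the relation of
  the snake lemma between cosets. It is well defined without reference to parity, so one and the same map
  serves for both connecting homomorphisms.

  To apply this, three facts about the tensor product with the spin module are needed. Tensoring
  preserves exactness, since sequences of vector spaces split (\<open>exact_tensor_map_id\<close>). The Dirac operator
  is a sum of terms whose Clifford factors are products of one or three vectors, hence odd
  (\<open>odd_operator_dirac_operator\<close>); this uses that a Lie algebra representation extends to the enveloping
  algebra. And the Dirac operator is natural: its enveloping algebra factors commute with homomorphisms of
  modules (\<open>dirac_operator_natural\<close>).\<close>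

section \<open>Linear maps and direct sums\<close>

interpretation clinear_pair: vector_space_pair
  "scaleC :: complex \<Rightarrow> 'a::complex_vector \<Rightarrow> 'a" "scaleC :: complex \<Rightarrow> 'b::complex_vector \<Rightarrow> 'b"
  by unfold_locales

lemma clinearI:
  assumes "\<And>x y. f (x + y) = f x + f y" and "\<And>c x. f (c *\<^sub>C x) = c *\<^sub>C f x"
  shows "clinear f"
  using assms by (simp add: Vector_Spaces.linear_iff complex_vector.vector_space_axioms)

lemmas clinear_simps =
  clinear_pair.linear_add clinear_pair.linear_scale clinear_pair.linear_diff
  clinear_pair.linear_0 clinear_pair.linear_neg

lemma clinear_ident: "clinear (\<lambda>x. x)"
  by (rule clinearI) auto

lemma clinear_compose: "clinear f \<Longrightarrow> clinear g \<Longrightarrow> clinear (\<lambda>x. g (f x))"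
  by (rule clinearI) (simp_all add: clinear_simps)

lemma clinear_eq_on_spanning:
  assumes "clinear f" "clinear g" "cspan B = UNIV" "\<And>b. b \<in> B \<Longrightarrow> f b = g b"
  shows "f x = g x"
  using clinear_pair.linear_eq_on[of f g x B] assms by simp

lemma clinear_sum_scale:
  assumes "\<And>k. k \<in> S \<Longrightarrow> clinear (f k)"
  shows "clinear (\<lambda>x. \<Sum>k\<in>S. c k *\<^sub>C f k x)"
  using assms
  by (intro clinearI)
    (simp_all add: clinear_simps sum.distrib scaleC_add_right scaleC_scaleC
      complex_vector.scale_sum_right mult.commute)

lemma clinear_image_span_subset:
  assumes "clinear f" "csubspace W" "f ` B \<subseteq> W" "x \<in> cspan B"
  shows "f x \<in> W"
  using assms
  by (metis clinear_pair.linear_span_image complex_vector.span_minimal imageI subset_iff)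

lemma direct_sum_decompose:
  assumes "direct_sum UNIV U V"
  shows "\<exists>u\<in>U. \<exists>v\<in>V. x = u + v"
proof -
  have "x \<in> {u + v | u v. u \<in> U \<and> v \<in> V}"
    using assms UNIV_I[of x] unfolding direct_sum_def by metis
  then show ?thesis by blast
qed

lemma direct_sum_projection:
  assumes "direct_sum UNIV U V"
  obtains \<pi> where "clinear \<pi>" "\<And>u. u \<in> U \<Longrightarrow> \<pi> u = u" "\<And>v. v \<in> V \<Longrightarrow> \<pi> v = 0"
proof -
  have U: "csubspace U" and V: "csubspace V" and UV: "U \<inter> V = {0}"
    using assms by (simp_all add: direct_sum_def)
  note ex = direct_sum_decompose[OF assms]
  have uniq: "u = u'" if "u \<in> U" "v \<in> V" "u' \<in> U" "v' \<in> V" "u + v = u' + v'" for u v u' v'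
  proof -
    have "u - u' = v' - v" using that(5) by (metis add_diff_cancel_left' add_diff_eq diff_add_eq add.commute)
    then have "u - u' \<in> U \<inter> V"
      using complex_vector.subspace_diff[OF U, of u u'] complex_vector.subspace_diff[OF V, of v' v] that
      by simp
    then show ?thesis using UV by simp
  qed
  define \<pi> where "\<pi> x = (SOME u. u \<in> U \<and> (\<exists>v\<in>V. x = u + v))" for x
  have eq: "\<pi> (u + v) = u" if "u \<in> U" "v \<in> V" for u v
    unfolding \<pi>_def using that by (rule_tac some_equality) (auto intro: uniq)
  show thesis
  proof
    show "clinear \<pi>"
    proof (rule clinearI)
      fix x y
      obtain u v u' v' where "u \<in> U" "v \<in> V" "x = u + v" "u' \<in> U" "v' \<in> V" "y = u' + v'"
        using ex by metis
      then show "\<pi> (x + y) = \<pi> x + \<pi> y"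
        using eq[of "u + u'" "v + v'"] eq[of u v] eq[of u' v']
          complex_vector.subspace_add[OF U] complex_vector.subspace_add[OF V]
        by (simp add: algebra_simps)
    next
      fix c x
      obtain u v where "u \<in> U" "v \<in> V" "x = u + v" using ex by metis
      then show "\<pi> (c *\<^sub>C x) = c *\<^sub>C \<pi> x"
        using eq[of "c *\<^sub>C u" "c *\<^sub>C v"] eq[of u v]
          complex_vector.subspace_scale[OF U] complex_vector.subspace_scale[OF V]
        by (simp add: scaleC_add_right)
    qed
    show "\<pi> u = u" if "u \<in> U" for u
      using eq[OF that complex_vector.subspace_0[OF V]] by simp
    show "\<pi> v = 0" if "v \<in> V" for v
      using eq[OF complex_vector.subspace_0[OF U] that] by simp
  qed
qed

section \<open>Diagonalizable operators\<close>

text \<open>An eigenvector lies in the kernel if its eigenvalue is \<open>0\<close>; otherwise it is \<open>T\<close> applied to a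
  multiple of itself.\<close>

lemma diagonalizable_kernel_plus_range:
  assumes "clinear T" "diagonalizable T"
  obtains y w where "x = y + T w" "T y = 0"
proof -
  have "x \<in> cspan {w. \<exists>c. T w = c *\<^sub>C w}" using assms(2) by (simp add: diagonalizable_def)
  then have "\<exists>y w. x = y + T w \<and> T y = 0"
  proof (induction rule: complex_vector.span_induct_alt)
    case base
    show ?case by (intro exI[of _ 0]) (simp add: clinear_simps[OF assms(1)])
  next
    case (step a v x)
    then obtain y w c where *: "x = y + T w" "T y = 0" "T v = c *\<^sub>C v" by blast
    show ?case
    proof (cases "c = 0")
      case True
      with * have "a *\<^sub>C v + x = (a *\<^sub>C v + y) + T w" "T (a *\<^sub>C v + y) = 0"
        by (simp_all add: clinear_simps[OF assms(1)] add.assoc)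
      then show ?thesis by blast
    next
      case False
      with * have "a *\<^sub>C v + x = y + T ((a / c) *\<^sub>C v + w)"
        by (simp add: clinear_simps[OF assms(1)] scaleC_scaleC algebra_simps)
      then show ?thesis using * by blast
    qed
  qed
  then show thesis using that by blast
qed

text \<open>The operator \<open>(T - c\<^sub>1) \<dots> (T - c\<^sub>n)\<close>. With nonzero \<open>c\<^sub>i\<close> it can annihilate the image of a given vector
  under a diagonalizable \<open>T\<close>, while it acts on the kernel of \<open>T\<close> by a nonzero scalar.\<close>

definition shift_product :: "('a::complex_vector \<Rightarrow> 'a) \<Rightarrow> complex list \<Rightarrow> 'a \<Rightarrow> 'a"
  where "shift_product T cs = foldr (\<lambda>c v. T v - c *\<^sub>C v) cs"

lemma clinear_shift_product: "clinear T \<Longrightarrow> clinear (shift_product T cs)"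
  by (induction cs)
    (auto simp: shift_product_def algebra_simps scaleC_add_right scaleC_scaleC clinear_simps intro!: clinearI
      complex_vector.scale_right_diff_distrib)

lemma shift_product_commute: "clinear T \<Longrightarrow> shift_product T cs (T v) = T (shift_product T cs v)"
  by (induction cs) (simp_all add: shift_product_def clinear_simps)

text \<open>A product of shifts by the nonzero eigenvalues occurring in \<open>w\<close> annihilates \<open>T w\<close>. If \<open>T w\<close> also
  lies in the kernel, each factor \<open>T - c\<close> multiplies it by \<open>- c\<close>, so it must vanish.\<close>

lemma diagonalizable_kernel_square:
  assumes T: "clinear T" "diagonalizable T" and "T (T w) = 0"
  shows "T w = 0"
proof -
  note S = clinear_shift_product[OF T(1)]
  have "w \<in> cspan {w. \<exists>c. T w = c *\<^sub>C w}" using assms(2) by (simp add: diagonalizable_def)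
  then have "\<exists>cs. 0 \<notin> set cs \<and> shift_product T cs (T w) = 0"
  proof (induction rule: complex_vector.span_induct_alt)
    case base
    show ?case by (intro exI[of _ "[]"]) (simp add: shift_product_def clinear_simps[OF T(1)])
  next
    case (step a v x)
    then obtain cs c where *: "0 \<notin> set cs" "shift_product T cs (T x) = 0" "T v = c *\<^sub>C v" by blast
    show ?case
    proof (cases "c = 0")
      case True
      then have "T (a *\<^sub>C v + x) = T x" using *(3) by (simp add: clinear_simps[OF T(1)])
      then show ?thesis using * by metis
    next
      case False
      have "T (shift_product T cs v) = c *\<^sub>C shift_product T cs v"
        using *(3) shift_product_commute[OF T(1), of cs v] by (simp add: clinear_simps[OF S])
      then have "shift_product T (c # cs) v = 0" by (simp add: shift_product_def)
      moreover have "shift_product T (c # cs) (T x) = 0"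
        using *(2) by (simp add: shift_product_def clinear_simps[OF T(1)])
      ultimately have "shift_product T (c # cs) (T (a *\<^sub>C v + x)) = 0"
        using *(3) by (simp add: clinear_simps[OF S] clinear_simps[OF T(1)])
      then show ?thesis using * False by (intro exI[of _ "c # cs"]) auto
    qed
  qed
  then obtain cs where cs: "0 \<notin> set cs" "shift_product T cs (T w) = 0" by blast
  \<comment> \<open>Since \<open>T w\<close> is in the kernel, the same operator acts on it as a scalar.\<close>
  have "shift_product T cs (T w) = (\<Prod>c\<leftarrow>cs. - c) *\<^sub>C T w"
    by (induction cs)
      (simp_all add: shift_product_def scaleC_one clinear_simps[OF T(1)] assms(3) scaleC_scaleC
        complex_vector.scale_minus_left)
  with cs show ?thesis by (auto simp: prod_list_zero_iff)
qed

text \<open>Passing to kernels is only left exact in general. Here, after writing a preimage of \<open>z\<close> as \<open>y + T w\<close> with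
  \<open>T y = 0\<close>, the error \<open>z - p y = T' (p w)\<close> lies both in the image and in the kernel of \<open>T'\<close>, and for a
  diagonalizable operator these meet in \<open>0\<close>. Thus \<open>y\<close> is already a lift.\<close>

lemma kernel_lift_of_diagonalizable:
  assumes p: "clinear p" "surj p" "\<And>y. p (T y) = T' (p y)"
    and T: "clinear T" "diagonalizable T" and T': "clinear T'" "diagonalizable T'"
    and z: "T' z = 0"
  shows "\<exists>y. T y = 0 \<and> p y = z"
proof -
  obtain y' where "p y' = z" using p(2) by (metis surjD)
  moreover obtain y w where y: "y' = y + T w" "T y = 0"
    using diagonalizable_kernel_plus_range[OF T] .
  ultimately have eq: "z = p y + T' (p w)" by (simp add: clinear_simps[OF p(1)] p(3))
  have "T' (p y) = 0" using y(2) p(1,3) by (metis clinear_pair.linear_0)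
  with eq z have "T' (T' (p w)) = 0" by (simp add: clinear_simps[OF T'(1)])
  then have "T' (p w) = 0" by (rule diagonalizable_kernel_square[OF T'])
  with eq y(2) show ?thesis by auto
qed

section \<open>Dirac cohomology classes and their representatives\<close>

lemma csubspace_boundaries:
  assumes "clinear D" shows "csubspace (boundaries D)"
proof -
  have "csubspace (range D)"
    using clinear_pair.linear_subspace_image[OF assms complex_vector.subspace_UNIV] .
  moreover have "csubspace (cycles D)"
    using clinear_pair.linear_subspace_kernel[OF assms] by (simp add: cycles_def)
  ultimately show ?thesis unfolding boundaries_def by (rule complex_vector.subspace_inter)
qed

text \<open>The boundaries are the image under \<open>D\<close> of the kernel of \<open>D\<^sup>2\<close>. Dirac cohomology is therefore the
  homology of \<open>D\<close> restricted to that kernel, where \<open>D\<close> squares to zero.\<close>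

lemma mem_boundaries_iff: "x \<in> boundaries D \<longleftrightarrow> (\<exists>w. x = D w \<and> D (D w) = 0)"
  by (auto simp: boundaries_def cycles_def)

context
  fixes D :: "'a::complex_vector \<Rightarrow> 'a"
  assumes D: "clinear D"
begin

lemma mem_dirac_class_iff: "y \<in> dirac_class D x \<longleftrightarrow> y - x \<in> boundaries D"
  by (auto simp: dirac_class_def) (metis add_diff_cancel_left' diff_add_cancel add.commute)

lemma dirac_class_eq_iff: "dirac_class D x = dirac_class D y \<longleftrightarrow> x - y \<in> boundaries D"
proof
  assume "dirac_class D x = dirac_class D y"
  moreover have "x \<in> dirac_class D x"
    using complex_vector.subspace_0[OF csubspace_boundaries[OF D]] by (simp add: mem_dirac_class_iff)
  ultimately show "x - y \<in> boundaries D" by (simp add: mem_dirac_class_iff)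
next
  assume *: "x - y \<in> boundaries D"
  have "z - x \<in> boundaries D \<longleftrightarrow> z - y \<in> boundaries D" for z
    using complex_vector.subspace_add[OF csubspace_boundaries[OF D] _ *, of "z - x"]
      complex_vector.subspace_diff[OF csubspace_boundaries[OF D] _ *, of "z - y"] by auto
  then show "dirac_class D x = dirac_class D y" by (auto simp: mem_dirac_class_iff)
qed

lemma dirac_class_0: "dirac_class D 0 = boundaries D"
  by (auto simp: mem_dirac_class_iff)

lemma dirac_class_eq_boundaries_iff: "dirac_class D x = boundaries D \<longleftrightarrow> x \<in> boundaries D"
  using dirac_class_eq_iff[of x 0] by (simp add: dirac_class_0)

lemma coset_add_dirac_class: "coset_add (dirac_class D x) (dirac_class D y) = dirac_class D (x + y)"
proof -
  have "\<exists>a b. z = a + b \<and> a - x \<in> boundaries D \<and> b - y \<in> boundaries D"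
    if "z - (x + y) \<in> boundaries D" for z
    using that complex_vector.subspace_0[OF csubspace_boundaries[OF D]]
    by (intro exI[of _ x] exI[of _ "z - x"]) (simp add: algebra_simps)
  moreover have "a + b - (x + y) \<in> boundaries D" if "a - x \<in> boundaries D" "b - y \<in> boundaries D" for a b
    using complex_vector.subspace_add[OF csubspace_boundaries[OF D] that] by (simp add: algebra_simps)
  ultimately show ?thesis by (auto simp: coset_add_def mem_dirac_class_iff)
qed

end

text \<open>This is \<open>graded_dirac_cohomology\<close> for an arbitrary space in place of a tensor product, so that the homological argument can be carried out
  without reference to tensors.\<close>

definition homogeneous_classes :: "'a::complex_vector set \<Rightarrow> ('a \<Rightarrow> 'a) \<Rightarrow> 'a set set"
  where "homogeneous_classes E D = {dirac_class D x | x. x \<in> E \<and> D x = 0}"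

lemma homogeneous_classes_iff:
  "A \<in> homogeneous_classes E D \<longleftrightarrow> (\<exists>x\<in>E. D x = 0 \<and> A = dirac_class D x)"
  by (auto simp: homogeneous_classes_def)

lemma graded_dirac_cohomology_eq:
  assumes D: "clinear D"
  shows "graded_dirac_cohomology E D = homogeneous_classes E D"
proof (intro set_eqI, unfold homogeneous_classes_iff, rule iffI)
  fix A
  assume "A \<in> graded_dirac_cohomology E D"
  then obtain x y where xy: "D x = 0" "A = dirac_class D x" "y \<in> A" "y \<in> E"
    by (auto simp: graded_dirac_cohomology_def dirac_cohomology_def cycles_def)
  then have "y - x \<in> boundaries D" by (simp add: mem_dirac_class_iff[OF D])
  moreover from this have "D y = 0"
    using xy(1) by (auto simp: mem_boundaries_iff clinear_simps[OF D] diff_eq_eq)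
  ultimately show "\<exists>x\<in>E. D x = 0 \<and> A = dirac_class D x"
    using xy dirac_class_eq_iff[OF D] by metis
next
  fix A
  assume "\<exists>x\<in>E. D x = 0 \<and> A = dirac_class D x"
  then show "A \<in> graded_dirac_cohomology E D"
    using complex_vector.subspace_0[OF csubspace_boundaries[OF D]]
    by (auto simp: graded_dirac_cohomology_def dirac_cohomology_def cycles_def
        mem_dirac_class_iff[OF D] disjoint_iff)
qed

lemma induced_map_dirac_class:
  assumes D: "clinear D" and D': "clinear D'" and T: "clinear T" "\<And>x. T (D x) = D' (T x)"
  shows "induced_map D' T (dirac_class D x) = dirac_class D' (T x)"
proof (intro set_eqI iffI)
  fix y assume "y \<in> induced_map D' T (dirac_class D x)"
  then obtain a b where *: "y = T a + b" "a - x \<in> boundaries D" "b \<in> boundaries D'"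
    by (auto simp: induced_map_def mem_dirac_class_iff[OF D])
  then obtain w where "a - x = D w" "D (D w) = 0" by (auto simp: mem_boundaries_iff)
  then have "T a - T x \<in> boundaries D'"
    using T by (metis clinear_pair.linear_0 clinear_pair.linear_diff mem_boundaries_iff)
  from complex_vector.subspace_add[OF csubspace_boundaries[OF D'] this *(3)]
  show "y \<in> dirac_class D' (T x)"
    using * by (simp add: mem_dirac_class_iff[OF D'] algebra_simps)
next
  fix y assume "y \<in> dirac_class D' (T x)"
  moreover have "x \<in> dirac_class D x"
    using complex_vector.subspace_0[OF csubspace_boundaries[OF D]] by (simp add: mem_dirac_class_iff[OF D])
  ultimately show "y \<in> induced_map D' T (dirac_class D x)"
    by (auto simp: induced_map_def mem_dirac_class_iff[OF D'] dirac_class_def[of D'])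
qed

lemma coset_scale_dirac_class:
  assumes "clinear D" shows "coset_scale D c (dirac_class D x) = dirac_class D (c *\<^sub>C x)"
  unfolding coset_scale_def using assms
  by (intro induced_map_dirac_class) (auto intro!: clinearI simp: clinear_simps scaleC_add_right scaleC_scaleC mult.commute)

lemma cohomology_hom_maps: "cohomology_hom D D' H H' f \<Longrightarrow> A \<in> H \<Longrightarrow> f A \<in> H'"
  by (auto simp: cohomology_hom_def)

text \<open>Linearity of a map of classes from a linear relation between representatives. For maps induced by
  linear maps \<open>R\<close> is their graph; the connecting map has no linear map behind it, since it depends on
  the choice of a lift, but it does come from a linear relation.\<close>

lemma cohomology_homI:
  fixes D :: "'a::complex_vector \<Rightarrow> 'a" and D' :: "'b::complex_vector \<Rightarrow> 'b"
  assumes D: "clinear D" "clinear D'"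
    and graph: "\<And>A. A \<in> H \<Longrightarrow> \<exists>x x'. R x x' \<and> A = dirac_class D x"
    and maps: "\<And>x x'. R x x' \<Longrightarrow> f (dirac_class D x) = dirac_class D' x'"
    and add: "\<And>x x' y y'. R x x' \<Longrightarrow> R y y' \<Longrightarrow> R (x + y) (x' + y')"
    and scale: "\<And>c x x'. R x x' \<Longrightarrow> R (c *\<^sub>C x) (c *\<^sub>C x')"
    and image: "f ` H \<subseteq> H'"
  shows "cohomology_hom D D' H H' f"
  unfolding cohomology_hom_def
proof (intro conjI ballI allI image)
  fix A B assume "A \<in> H" "B \<in> H"
  then obtain x x' y y' where "R x x'" "A = dirac_class D x" "R y y'" "B = dirac_class D y"
    using graph by metis
  then show "f (coset_add A B) = coset_add (f A) (f B)"
    using maps add by (simp add: coset_add_dirac_class D)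
next
  fix c A assume "A \<in> H"
  then obtain x x' where "R x x'" "A = dirac_class D x" using graph by metis
  then show "f (coset_scale D c A) = coset_scale D' c (f A)"
    using maps scale by (simp add: coset_scale_dirac_class D)
qed

lemma exact_atI:
  assumes "\<And>A. A \<in> H \<Longrightarrow> f A \<in> H' \<and> g (f A) = boundaries D''"
    and "\<And>A. A \<in> H' \<Longrightarrow> g A = boundaries D'' \<Longrightarrow> \<exists>B\<in>H. A = f B"
  shows "exact_at D'' H H' f g"
  using assms by (fastforce simp: exact_at_def)

section \<open>Exact sequences of graded spaces with odd operators\<close>

lemma bit_add_one_one: "\<epsilon> + 1 + 1 = (\<epsilon> :: bit)"
  by (cases \<epsilon>) simp_all

locale odd_operator =
  fixes D :: "'a::complex_vector \<Rightarrow> 'a" and E :: "bit \<Rightarrow> 'a set"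
  assumes linear: "clinear D"
    and grading: "direct_sum UNIV (E 0) (E 1)"
    and odd: "v \<in> E \<epsilon> \<Longrightarrow> D v \<in> E (\<epsilon> + 1)"
begin

lemma subspace: "csubspace (E \<epsilon>)"
  using grading by (cases \<epsilon>) (auto simp: direct_sum_def)

lemma decompose: "\<exists>u\<in>E \<epsilon>. \<exists>w\<in>E (\<epsilon> + 1). v = u + w"
proof -
  obtain a b where "a \<in> E 0" "b \<in> E 1" "v = a + b"
    using direct_sum_decompose[OF grading] by blast
  then show ?thesis
    by (cases \<epsilon>) (auto intro: bexI[of _ a] bexI[of _ b] simp: add.commute)
qed

lemma disjoint: "v \<in> E \<epsilon> \<Longrightarrow> v \<in> E (\<epsilon> + 1) \<Longrightarrow> v = 0"
  using grading by (cases \<epsilon>) (auto simp: direct_sum_def)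

lemma even_square: "v \<in> E \<epsilon> \<Longrightarrow> D (D v) \<in> E \<epsilon>"
  using odd[OF odd, of v \<epsilon>] by (simp only: bit_add_one_one)

lemma components_zero:
  assumes "u \<in> E \<epsilon>" "w \<in> E (\<epsilon> + 1)" "u + w \<in> E \<epsilon>"
  shows "w = 0"
  using complex_vector.subspace_diff[OF subspace assms(3,1)] assms(2) disjoint by simp

text \<open>Since \<open>D\<close> is odd, discarding the component of \<open>v\<close> of the wrong parity does not change \<open>D v\<close> if
  the latter is homogeneous.\<close>

lemma homogeneous_boundary:
  assumes "x \<in> boundaries D" "x \<in> E \<epsilon>"
  obtains w where "w \<in> E (\<epsilon> + 1)" "x = D w" "D (D w) = 0"
proof -
  obtain v where v: "x = D v" "D (D v) = 0" using assms(1) by (auto simp: mem_boundaries_iff)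
  obtain u w where uw: "u \<in> E \<epsilon>" "w \<in> E (\<epsilon> + 1)" "v = u + w" using decompose by blast
  have "D w \<in> E \<epsilon>" using odd[OF uw(2)] by (simp only: bit_add_one_one)
  moreover have "D w + D u \<in> E \<epsilon>"
    using assms(2) v(1) uw(3) by (simp add: clinear_simps[OF linear] add.commute)
  ultimately have "D u = 0" using components_zero odd[OF uw(1)] by blast
  then show thesis using that[OF uw(2)] v uw(3) by (simp add: clinear_simps[OF linear])
qed

end

text \<open>The assumption \<open>kernel_lift\<close> says that the sequence of kernels of \<open>D\<^sup>2\<close> is exact also at its right
  end. This turns the data into a short exact sequence of two-periodic complexes, to which the classical
  construction of the long exact sequence applies. Each exactness proof below chooses homogeneous
  representatives, so that parities are respected throughout.\<close>

locale odd_exact_sequence =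
  X: odd_operator DX GX + Y: odd_operator DY GY + Z: odd_operator DZ GZ
  for DX :: "'x::complex_vector \<Rightarrow> 'x" and GX
    and DY :: "'y::complex_vector \<Rightarrow> 'y" and GY
    and DZ :: "'z::complex_vector \<Rightarrow> 'z" and GZ +
  fixes i :: "'x \<Rightarrow> 'y" and p :: "'y \<Rightarrow> 'z"
  assumes linear_i: "clinear i" and linear_p: "clinear p"
    and i_commute: "i (DX x) = DY (i x)" and p_commute: "p (DY y) = DZ (p y)"
    and i_even: "x \<in> GX \<epsilon> \<Longrightarrow> i x \<in> GY \<epsilon>" and p_even: "y \<in> GY \<epsilon> \<Longrightarrow> p y \<in> GZ \<epsilon>"
    and inj_i: "inj i" and exact: "range i = {y. p y = 0}"
    and kernel_lift: "DZ (DZ z) = 0 \<Longrightarrow> \<exists>y. DY (DY y) = 0 \<and> p y = z"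
begin

lemma i_eq_0_iff: "i x = 0 \<longleftrightarrow> x = 0"
  using inj_i by (metis clinear_pair.linear_0[OF linear_i] injD)

lemma p_i: "p (i x) = 0"
  using exact by auto

lemma homogeneous_preimage:
  assumes "i x \<in> GY \<epsilon>" shows "x \<in> GX \<epsilon>"
proof -
  obtain u w where uw: "u \<in> GX \<epsilon>" "w \<in> GX (\<epsilon> + 1)" "x = u + w" using X.decompose by blast
  then have "i w = 0"
    using Y.components_zero[OF i_even i_even] assms by (simp add: clinear_simps[OF linear_i])
  with uw show ?thesis by (simp add: i_eq_0_iff)
qed

text \<open>The homogeneous component of a lift is again a lift, because \<open>p\<close> and \<open>D\<^sup>2\<close> preserve parity.\<close>

lemma homogeneous_kernel_lift:
  assumes "z \<in> GZ \<epsilon>" "DZ (DZ z) = 0"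
  obtains y where "y \<in> GY \<epsilon>" "DY (DY y) = 0" "p y = z"
proof -
  obtain y where y: "DY (DY y) = 0" "p y = z" using kernel_lift assms by blast
  obtain u w where uw: "u \<in> GY \<epsilon>" "w \<in> GY (\<epsilon> + 1)" "y = u + w" using Y.decompose by blast
  have sum: "DY (DY u) + DY (DY w) = 0"
    using y(1) uw(3) by (simp add: clinear_simps[OF Y.linear])
  then have "DY (DY w) = 0"
    using Y.components_zero[OF Y.even_square[OF uw(1)] Y.even_square[OF uw(2)]]
      complex_vector.subspace_0[OF Y.subspace] by metis
  with sum have "DY (DY u) = 0" by simp
  moreover have "p w = 0"
    using Z.components_zero[OF p_even[OF uw(1)] p_even[OF uw(2)]] assms(1) y(2) uw(3)
    by (simp add: clinear_simps[OF linear_p])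
  ultimately show thesis using that[OF uw(1)] uw(3) y(2) by (simp add: clinear_simps[OF linear_p])
qed

text \<open>The connecting map as the relation of the snake lemma between cosets, free of choices and of parity:
  lift through \<open>p\<close>, apply \<open>D\<close>, and pull back along \<open>i\<close>. Such a lift lies in the
  kernel of \<open>D\<^sup>2\<close>, because \<open>D\<^sup>2 y = i (D x) = 0\<close>.\<close>

definition connecting :: "'z set \<Rightarrow> 'x set"
  where "connecting A = {x. DX x = 0 \<and> (\<exists>y. p y \<in> A \<and> DY y = i x)}"

text \<open>The relation is single-valued on cosets: two lifts of cohomologous cycles differ by \<open>D v + i u\<close> for
  some \<open>v\<close> in the kernel of \<open>D\<^sup>2\<close>, whence their images under \<open>D\<close> differ by \<open>i (D u)\<close>. Conversely, adding
  \<open>i u\<close> to a lift realizes every representative of the class of \<open>x\<close>.\<close>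

lemma connecting_dirac_class:
  assumes "DX x = 0" "DY y = i x"
  shows "connecting (dirac_class DZ (p y)) = dirac_class DX x"
proof (intro set_eqI iffI)
  fix x' assume "x' \<in> connecting (dirac_class DZ (p y))"
  then obtain y' where x': "DX x' = 0" "p y' - p y \<in> boundaries DZ" "DY y' = i x'"
    by (auto simp: connecting_def mem_dirac_class_iff[OF Z.linear])
  then obtain z where z: "p y' - p y = DZ z" "DZ (DZ z) = 0" by (auto simp: mem_boundaries_iff)
  obtain v where v: "DY (DY v) = 0" "p v = z" using kernel_lift[OF z(2)] by blast
  have "p (y' - y - DY v) = 0" using z v by (simp add: clinear_simps[OF linear_p] p_commute)
  then obtain u where u: "y' - y - DY v = i u" using exact by blast
  have "i (x' - x) = i (DX u)"
    using arg_cong[OF u, of DY] x'(3) assms(2) v(1)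
    by (simp add: clinear_simps[OF Y.linear] clinear_simps[OF linear_i] i_commute)
  then have "x' - x = DX u" using inj_i by (simp add: inj_eq)
  moreover have "DX (x' - x) = 0"
    using x'(1) assms(1) by (simp add: clinear_simps[OF X.linear])
  ultimately show "x' \<in> dirac_class DX x"
    unfolding mem_dirac_class_iff[OF X.linear] mem_boundaries_iff by metis
next
  fix x' assume "x' \<in> dirac_class DX x"
  then obtain u where u: "x' - x = DX u" "DX (DX u) = 0"
    by (auto simp: mem_dirac_class_iff[OF X.linear] mem_boundaries_iff)
  then have x': "x' = x + DX u" by (simp add: algebra_simps)
  have "DX x' = 0" "DY (y + i u) = i x'"
    using assms u(2) by (simp_all add: x' clinear_simps[OF X.linear] clinear_simps[OF Y.linear]
        clinear_simps[OF linear_i] i_commute)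
  moreover have "p (y + i u) \<in> dirac_class DZ (p y)"
    using complex_vector.subspace_0[OF csubspace_boundaries[OF Z.linear]]
    by (simp add: mem_dirac_class_iff[OF Z.linear] clinear_simps[OF linear_p] p_i)
  ultimately show "x' \<in> connecting (dirac_class DZ (p y))" by (auto simp: connecting_def)
qed

lemma boundary_lift:
  assumes "DY (DY y) = 0" "DZ (p y) = 0"
  obtains x where "DY y = i x" "DX x = 0"
proof -
  have "p (DY y) = 0" using assms(2) by (simp add: p_commute)
  then obtain x where x: "DY y = i x" using exact by blast
  then have "i (DX x) = 0" using assms(1) by (simp add: i_commute)
  with x show thesis using that i_eq_0_iff by blast
qed

lemma connecting_map_connecting: "connecting_map DX DY DZ GX GY GZ i p \<epsilon> connecting"
  unfolding connecting_map_def
proof (intro ballI conjI allI impI)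
  fix z assume "z \<in> cycles DZ \<inter> GZ \<epsilon>"
  then have z: "z \<in> GZ \<epsilon>" "DZ z = 0" by (auto simp: cycles_def)
  show "\<exists>y\<in>GY \<epsilon>. p y = z \<and> DY (DY y) = 0"
    using homogeneous_kernel_lift[OF z(1)] z(2) by (metis clinear_pair.linear_0[OF Z.linear])
  fix y assume y: "y \<in> GY \<epsilon>" "p y = z \<and> DY (DY y) = 0"
  then obtain x where x: "DY y = i x" "DX x = 0" using boundary_lift z(2) by blast
  then show "\<exists>!x. DY y = i x" using inj_i by (auto simp: inj_eq)
  fix x' assume "DY y = i x'"
  then have x': "DY y = i x'" "DX x' = 0" using x inj_i by (auto simp: inj_eq)
  then show "DX x' = 0" by simp
  show "x' \<in> GX (\<epsilon> + 1)" using homogeneous_preimage Y.odd[OF y(1)] x'(1) by simp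
  show "connecting (dirac_class DZ z) = dirac_class DX x'"
    using connecting_dirac_class x' y(2) by blast
qed

abbreviation "HX \<epsilon> \<equiv> homogeneous_classes (GX \<epsilon>) DX"
abbreviation "HY \<epsilon> \<equiv> homogeneous_classes (GY \<epsilon>) DY"
abbreviation "HZ \<epsilon> \<equiv> homogeneous_classes (GZ \<epsilon>) DZ"

lemmas induced_i = induced_map_dirac_class[OF X.linear Y.linear linear_i i_commute]
lemmas induced_p = induced_map_dirac_class[OF Y.linear Z.linear linear_p p_commute]





text \<open>The zigzag that computes the connecting map, with all representatives homogeneous.\<close>

lemma homogeneous_class_lift:
  assumes "A \<in> HZ \<epsilon>"
  obtains x y where "x \<in> GX (\<epsilon> + 1)" "y \<in> GY \<epsilon>" "DX x = 0" "DY y = i x" "A = dirac_class DZ (p y)"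
proof -
  obtain z where z: "z \<in> GZ \<epsilon>" "DZ z = 0" "A = dirac_class DZ z" using assms homogeneous_classes_iff by blast
  obtain y where y: "y \<in> GY \<epsilon>" "DY (DY y) = 0" "p y = z"
    using homogeneous_kernel_lift[OF z(1)] z(2) by (metis clinear_pair.linear_0[OF Z.linear])
  moreover obtain x where "DY y = i x" "DX x = 0" using boundary_lift y z(2) by blast
  ultimately show thesis using that homogeneous_preimage Y.odd z(3) by metis
qed

lemma cohomology_hom_i: "cohomology_hom DX DY (HX \<epsilon>) (HY \<epsilon>) (induced_map DY i)"
proof (rule cohomology_homI[where R = "\<lambda>x y. y = i x", OF X.linear Y.linear])
  show "induced_map DY i ` HX \<epsilon> \<subseteq> HY \<epsilon>"
  proof safe
    fix A assume "A \<in> HX \<epsilon>"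
    then obtain x where "x \<in> GX \<epsilon>" "DX x = 0" "A = dirac_class DX x" unfolding homogeneous_classes_iff by blast
    then show "induced_map DY i A \<in> HY \<epsilon>"
      using i_even i_commute[of x, symmetric] by (auto simp: homogeneous_classes_iff induced_i clinear_simps[OF linear_i])
  qed
qed (auto simp: homogeneous_classes_iff induced_i clinear_simps[OF linear_i])

lemma cohomology_hom_p: "cohomology_hom DY DZ (HY \<epsilon>) (HZ \<epsilon>) (induced_map DZ p)"
proof (rule cohomology_homI[where R = "\<lambda>y z. z = p y", OF Y.linear Z.linear])
  show "induced_map DZ p ` HY \<epsilon> \<subseteq> HZ \<epsilon>"
  proof safe
    fix A assume "A \<in> HY \<epsilon>"
    then obtain y where "y \<in> GY \<epsilon>" "DY y = 0" "A = dirac_class DY y" unfolding homogeneous_classes_iff by blast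
    then show "induced_map DZ p A \<in> HZ \<epsilon>"
      using p_even p_commute[of y, symmetric] by (auto simp: homogeneous_classes_iff induced_p clinear_simps[OF linear_p])
  qed
qed (auto simp: homogeneous_classes_iff induced_p clinear_simps[OF linear_p])

lemma cohomology_hom_connecting: "cohomology_hom DZ DX (HZ \<epsilon>) (HX (\<epsilon> + 1)) connecting"
proof (rule cohomology_homI[where R = "\<lambda>z x. \<exists>y. z = p y \<and> DX x = 0 \<and> DY y = i x", OF Z.linear X.linear])
  show "connecting ` HZ \<epsilon> \<subseteq> HX (\<epsilon> + 1)"
  proof safe
    fix A assume "A \<in> HZ \<epsilon>"
    then obtain x y where "x \<in> GX (\<epsilon> + 1)" "DX x = 0" "DY y = i x" "A = dirac_class DZ (p y)"
      by (rule homogeneous_class_lift)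
    then show "connecting A \<in> HX (\<epsilon> + 1)" by (auto simp: homogeneous_classes_iff connecting_dirac_class)
  qed
next
  fix A assume "A \<in> HZ \<epsilon>"
  then obtain x y where "DX x = 0" "DY y = i x" "A = dirac_class DZ (p y)"
    by (rule homogeneous_class_lift)
  then show "\<exists>z x. (\<exists>y. z = p y \<and> DX x = 0 \<and> DY y = i x) \<and> A = dirac_class DZ z" by blast
next
  fix z x z' x'
  assume "\<exists>y. z = p y \<and> DX x = 0 \<and> DY y = i x" "\<exists>y. z' = p y \<and> DX x' = 0 \<and> DY y = i x'"
  then obtain y y' where "z = p y" "DX x = 0" "DY y = i x" "z' = p y'" "DX x' = 0" "DY y' = i x'"
    by blast
  then show "\<exists>y. z + z' = p y \<and> DX (x + x') = 0 \<and> DY y = i (x + x')"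
    by (intro exI[of _ "y + y'"])
      (simp add: clinear_simps[OF linear_p] clinear_simps[OF linear_i] clinear_simps[OF X.linear]
        clinear_simps[OF Y.linear])
next
  fix c z x
  assume "\<exists>y. z = p y \<and> DX x = 0 \<and> DY y = i x"
  then obtain y where "z = p y" "DX x = 0" "DY y = i x" by blast
  then show "\<exists>y. c *\<^sub>C z = p y \<and> DX (c *\<^sub>C x) = 0 \<and> DY y = i (c *\<^sub>C x)"
    by (intro exI[of _ "c *\<^sub>C y"])
      (simp add: clinear_simps[OF linear_p] clinear_simps[OF linear_i] clinear_simps[OF X.linear]
        clinear_simps[OF Y.linear])
qed (auto simp: connecting_dirac_class)

text \<open>If the class of \<open>p y\<close> vanishes, then \<open>p y = D z\<close> with \<open>z\<close> in the kernel of \<open>D\<^sup>2\<close>. Subtracting from \<open>y\<close>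
  the boundary of a lift of \<open>z\<close> moves it into the image of \<open>i\<close> without changing its class.\<close>

lemma exact_at_Y: "exact_at DZ (HX \<epsilon>) (HY \<epsilon>) (induced_map DY i) (induced_map DZ p)"
proof (rule exact_atI)
  fix A assume A: "A \<in> HX \<epsilon>"
  then obtain x where "A = dirac_class DX x" unfolding homogeneous_classes_iff by blast
  then have "induced_map DZ p (induced_map DY i A) = boundaries DZ"
    by (simp add: induced_i induced_p p_i dirac_class_0[OF Z.linear])
  then show "induced_map DY i A \<in> HY \<epsilon> \<and> induced_map DZ p (induced_map DY i A) = boundaries DZ"
    using cohomology_hom_maps[OF cohomology_hom_i A] by blast
next
  fix A assume A: "A \<in> HY \<epsilon>" "induced_map DZ p A = boundaries DZ"
  then obtain y where y: "y \<in> GY \<epsilon>" "DY y = 0" "A = dirac_class DY y" unfolding homogeneous_classes_iff by blast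
  with A have "p y \<in> boundaries DZ"
    by (simp add: induced_p dirac_class_eq_boundaries_iff[OF Z.linear])
  then obtain z where z: "z \<in> GZ (\<epsilon> + 1)" "p y = DZ z" "DZ (DZ z) = 0"
    using Z.homogeneous_boundary p_even[OF y(1)] by blast
  obtain v where v: "v \<in> GY (\<epsilon> + 1)" "DY (DY v) = 0" "p v = z"
    using homogeneous_kernel_lift[OF z(1,3)] .
  have "p (y - DY v) = 0" using z v by (simp add: clinear_simps[OF linear_p] p_commute)
  then obtain x where x: "y - DY v = i x" using exact by blast
  have "DY v \<in> GY \<epsilon>" using Y.odd[OF v(1)] by (simp only: bit_add_one_one)
  then have "x \<in> GX \<epsilon>"
    using homogeneous_preimage complex_vector.subspace_diff[OF Y.subspace y(1)] x by metis
  moreover have "i (DX x) = 0"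
    using x[symmetric] y(2) v(2) by (simp add: i_commute clinear_simps[OF Y.linear])
  ultimately have "dirac_class DX x \<in> HX \<epsilon>" unfolding homogeneous_classes_iff i_eq_0_iff by blast
  moreover have "y - i x = DY v" by (simp add: x[symmetric])
  then have "y - i x \<in> boundaries DY" unfolding mem_boundaries_iff using v(2) by blast
  then have "A = induced_map DY i (dirac_class DX x)"
    by (simp add: y(3) induced_i dirac_class_eq_iff[OF Y.linear])
  ultimately show "\<exists>B\<in>HX \<epsilon>. A = induced_map DY i B" by blast
qed

text \<open>If the connecting map sends the class of \<open>p y\<close> to zero, then \<open>D y = i (D w)\<close>, and \<open>y - i w\<close> is a cycle
  that also lifts \<open>p y\<close>.\<close>

lemma exact_at_Z: "exact_at DX (HY \<epsilon>) (HZ \<epsilon>) (induced_map DZ p) connecting"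
proof (rule exact_atI)
  fix A assume A: "A \<in> HY \<epsilon>"
  then obtain y where "DY y = 0" "A = dirac_class DY y" unfolding homogeneous_classes_iff by blast
  then have "connecting (induced_map DZ p A) = boundaries DX"
    using connecting_dirac_class[of 0 y]
    by (simp add: induced_p clinear_simps[OF X.linear] clinear_simps[OF linear_i] dirac_class_0[OF X.linear])
  then show "induced_map DZ p A \<in> HZ \<epsilon> \<and> connecting (induced_map DZ p A) = boundaries DX"
    using cohomology_hom_maps[OF cohomology_hom_p A] by blast
next
  fix A assume A: "A \<in> HZ \<epsilon>" "connecting A = boundaries DX"
  obtain x y where xy: "x \<in> GX (\<epsilon> + 1)" "y \<in> GY \<epsilon>" "DX x = 0" "DY y = i x" "A = dirac_class DZ (p y)"
    using homogeneous_class_lift[OF A(1)] .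
  with A(2) have "x \<in> boundaries DX"
    by (simp add: connecting_dirac_class dirac_class_eq_boundaries_iff[OF X.linear])
  then obtain w where w: "w \<in> GX (\<epsilon> + 1 + 1)" "x = DX w"
    using X.homogeneous_boundary[OF _ xy(1)] by blast
  then have "w \<in> GX \<epsilon>" by (simp only: bit_add_one_one)
  then have "y - i w \<in> GY \<epsilon>"
    using complex_vector.subspace_diff[OF Y.subspace xy(2) i_even] by blast
  moreover have "DY (y - i w) = 0"
    using xy(4) w(2) by (simp add: clinear_simps[OF Y.linear] i_commute)
  ultimately have "dirac_class DY (y - i w) \<in> HY \<epsilon>" unfolding homogeneous_classes_iff by blast
  moreover have "A = induced_map DZ p (dirac_class DY (y - i w))"
    by (simp add: induced_p xy(5) clinear_simps[OF linear_p] p_i)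
  ultimately show "\<exists>B\<in>HY \<epsilon>. A = induced_map DZ p B" by blast
qed

text \<open>If \<open>i x\<close> is a boundary \<open>D y\<close>, then \<open>p y\<close> is a cycle and \<open>y\<close> exhibits \<open>x\<close> as its image under the
  connecting map.\<close>

lemma exact_at_X: "exact_at DY (HZ \<epsilon>) (HX (\<epsilon> + 1)) connecting (induced_map DY i)"
proof (rule exact_atI)
  fix A assume A: "A \<in> HZ \<epsilon>"
  obtain x y where xy: "DX x = 0" "DY y = i x" "A = dirac_class DZ (p y)"
    using homogeneous_class_lift[OF A] .
  have "DY (i x) = 0" using xy(1) i_commute[of x] by (simp add: clinear_simps[OF linear_i])
  then have "i x \<in> boundaries DY" using xy(2) unfolding mem_boundaries_iff by metis
  then have "induced_map DY i (connecting A) = boundaries DY"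
    using xy by (simp add: connecting_dirac_class induced_i dirac_class_eq_boundaries_iff[OF Y.linear])
  then show "connecting A \<in> HX (\<epsilon> + 1) \<and> induced_map DY i (connecting A) = boundaries DY"
    using cohomology_hom_maps[OF cohomology_hom_connecting A] by blast
next
  fix A assume A: "A \<in> HX (\<epsilon> + 1)" "induced_map DY i A = boundaries DY"
  then obtain x where x: "x \<in> GX (\<epsilon> + 1)" "DX x = 0" "A = dirac_class DX x" unfolding homogeneous_classes_iff by blast
  with A have "i x \<in> boundaries DY"
    by (simp add: induced_i dirac_class_eq_boundaries_iff[OF Y.linear])
  then obtain y where y: "y \<in> GY (\<epsilon> + 1 + 1)" "i x = DY y"
    using Y.homogeneous_boundary[OF _ i_even[OF x(1)]] by blast
  have "p y \<in> GZ \<epsilon>" using p_even[OF y(1)] by (simp only: bit_add_one_one)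
  moreover have "DZ (p y) = 0" using y(2)[symmetric] by (simp add: p_commute[symmetric] p_i)
  ultimately have "dirac_class DZ (p y) \<in> HZ \<epsilon>" unfolding homogeneous_classes_iff by blast
  moreover have "A = connecting (dirac_class DZ (p y))"
    using connecting_dirac_class x y(2) by simp
  ultimately show "\<exists>B\<in>HZ \<epsilon>. A = connecting B" by blast
qed

end

section \<open>Tensor products of linear maps\<close>

definition linear_extension :: "('k \<Rightarrow> 'c::complex_vector) \<Rightarrow> ('k \<Rightarrow>\<^sub>0 complex) \<Rightarrow> 'c"
  where "linear_extension g p = (\<Sum>k\<in>Poly_Mapping.keys p. Poly_Mapping.lookup p k *\<^sub>C g k)"

lemma linear_extension_superset:
  assumes "finite S" "Poly_Mapping.keys p \<subseteq> S"
  shows "linear_extension g p = (\<Sum>k\<in>S. Poly_Mapping.lookup p k *\<^sub>C g k)"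
  unfolding linear_extension_def
  by (rule sum.mono_neutral_left) (use assms in \<open>auto simp: in_keys_iff\<close>)

lemma clinear_linear_extension: "clinear (linear_extension g)"
proof (rule clinearI)
  fix p q :: "'a \<Rightarrow>\<^sub>0 complex"
  let ?S = "Poly_Mapping.keys p \<union> Poly_Mapping.keys q"
  have "Poly_Mapping.keys (p + q) \<subseteq> ?S" by (rule keys_add)
  then show "linear_extension g (p + q) = linear_extension g p + linear_extension g q"
    by (simp add: linear_extension_superset[of ?S] lookup_add scaleC_add_left sum.distrib)
next
  fix c and p :: "'a \<Rightarrow>\<^sub>0 complex"
  have "Poly_Mapping.keys (c *\<^sub>C p) \<subseteq> Poly_Mapping.keys p"
    by (auto simp: in_keys_iff lookup_scaleC)
  then show "linear_extension g (c *\<^sub>C p) = c *\<^sub>C linear_extension g p"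
    by (simp add: linear_extension_superset[of "Poly_Mapping.keys p"] lookup_scaleC
        complex_vector.scale_sum_right scaleC_scaleC scaleC_complex_def)
qed

lemma linear_extension_single: "linear_extension g (Poly_Mapping.single k c) = c *\<^sub>C g k"
  by (simp add: linear_extension_superset[of "{k}"])

lemma cspan_single: "cspan (range (\<lambda>k. Poly_Mapping.single k (1::complex))) = UNIV"
proof -
  let ?B = "range (\<lambda>k. Poly_Mapping.single k (1::complex))"
  have "p \<in> cspan ?B" for p :: "'a \<Rightarrow>\<^sub>0 complex"
  proof (induction p rule: update_induct)
    case const
    show ?case by (rule complex_vector.span_zero)
  next
    case (update p k v)
    have "Poly_Mapping.update k v p = p + v *\<^sub>C Poly_Mapping.single k 1"
      using update.hyps(1) by (intro poly_mapping_eqI)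
        (auto simp: lookup_update lookup_add lookup_single lookup_scaleC when_def
          scaleC_complex_def not_in_keys_iff_lookup_eq_zero)
    with update.IH show ?case
      by (metis complex_vector.span_add complex_vector.span_base complex_vector.span_scale rangeI)
  qed
  then show ?thesis by blast
qed

lemma clinear_eq_poly_mapping:
  assumes "clinear f" "clinear g" "\<And>k. f (Poly_Mapping.single k (1::complex)) = g (Poly_Mapping.single k 1)"
  shows "f p = g p"
  by (rule clinear_eq_on_spanning[OF assms(1,2) cspan_single]) (use assms(3) in auto)

lemma tensor_prod_simps:
  shows tensor_prod_add_left: "(a + a') \<otimes>\<^sub>C b = a \<otimes>\<^sub>C b + a' \<otimes>\<^sub>C b"
    and tensor_prod_add_right: "a \<otimes>\<^sub>C (b + b') = a \<otimes>\<^sub>C b + a \<otimes>\<^sub>C b'"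
    and tensor_prod_scale_left: "(c *\<^sub>C a) \<otimes>\<^sub>C b = c *\<^sub>C (a \<otimes>\<^sub>C b)"
    and tensor_prod_scale_right: "a \<otimes>\<^sub>C (c *\<^sub>C b) = c *\<^sub>C (a \<otimes>\<^sub>C b)"
  by (transfer, unfold tensor_equiv_def, rule complex_vector.span_base,
      simp add: diff_diff_eq[symmetric] tensor_relations.intros)+

lemma abs_tensor_linear:
  "abs_tensor (p + q) = abs_tensor p + abs_tensor q" "abs_tensor (c *\<^sub>C p) = c *\<^sub>C abs_tensor p"
  by (simp_all add: plus_tensor.abs_eq scaleC_tensor.abs_eq)

lemma tensor_exhaust:
  obtains p where "t = abs_tensor p"
  by (metis Quotient_abs_rep Quotient_tensor)

lemma cspan_tensor_prod: "cspan {a \<otimes>\<^sub>C b | a b. True} = UNIV"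
proof -
  have "clinear abs_tensor" by (rule clinearI) (simp_all add: abs_tensor_linear)
  then have "cspan (abs_tensor ` range (\<lambda>k. Poly_Mapping.single k 1)) = range abs_tensor"
    using clinear_pair.linear_span_image[of abs_tensor "range (\<lambda>k. Poly_Mapping.single k 1)"]
    by (simp add: cspan_single)
  moreover have "abs_tensor ` range (\<lambda>k. Poly_Mapping.single k 1) = {a \<otimes>\<^sub>C b | a b. True}"
    by (auto simp: tensor_prod.abs_eq formal_tensor_def image_image)
  moreover have "range abs_tensor = UNIV"
    using tensor_exhaust by (metis surjI UNIV_eq_I rangeI)
  ultimately show ?thesis by metis
qed

lemma clinear_eq_tensor:
  assumes "clinear f" "clinear g" "\<And>a b. f (a \<otimes>\<^sub>C b) = g (a \<otimes>\<^sub>C b)"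
  shows "f t = g t"
  by (rule clinear_eq_on_spanning[OF assms(1,2) cspan_tensor_prod]) (use assms(3) in auto)

lemma tensor_lift_eq: "tensor_lift f t = linear_extension (\<lambda>k. f (fst k) (snd k)) (rep_tensor t)"
  by (simp add: tensor_lift_def linear_extension_def Let_def)

text \<open>For bilinear \<open>f\<close> the linear extension vanishes on the relations that define the tensor product, so any
  representative may be used in place of the chosen one.\<close>

lemma tensor_lift_abs:
  assumes "\<And>b. clinear (\<lambda>a. f a b)" "\<And>a. clinear (f a)"
  shows "tensor_lift f (abs_tensor p) = linear_extension (\<lambda>k. f (fst k) (snd k)) p"
proof -
  let ?f = "\<lambda>k. f (fst k) (snd k)"
  note L = clinear_simps[OF clinear_linear_extension[of ?f]]
  have rel: "linear_extension ?f r = 0" if "r \<in> tensor_relations" for r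
    using that
    by cases (simp_all add: L formal_tensor_def linear_extension_single scaleC_one
        clinear_simps[OF assms(1)] clinear_simps[OF assms(2)])
  have "linear_extension ?f r = 0" if "r \<in> cspan tensor_relations" for r
    using clinear_pair.linear_eq_0_on_span[OF clinear_linear_extension rel that] .
  moreover have "tensor_equiv (rep_tensor (abs_tensor p)) p"
    using Quotient_abs_rep[OF Quotient_tensor] by (simp only: tensor.abs_eq_iff[symmetric])
  ultimately have "linear_extension ?f (rep_tensor (abs_tensor p) - p) = 0"
    by (simp add: tensor_equiv_def)
  then show ?thesis by (simp add: tensor_lift_eq L)
qed

lemma tensor_lift_bilinear:
  fixes f :: "'a::complex_vector \<Rightarrow> 'b::complex_vector \<Rightarrow> 'c::complex_vector"
  assumes "\<And>b. clinear (\<lambda>a. f a b)" "\<And>a. clinear (f a)"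
  shows clinear_tensor_lift: "clinear (tensor_lift f)"
    and tensor_lift_tensor_prod: "tensor_lift f (a \<otimes>\<^sub>C b) = f a b"
proof -
  note abs = tensor_lift_abs[of f, OF assms]
  note L = clinear_simps[OF clinear_linear_extension]
  show "clinear (tensor_lift f)"
  proof (rule clinearI)
    fix s t :: "('a, 'b) tensor"
    obtain p q where "s = abs_tensor p" "t = abs_tensor q" using tensor_exhaust by metis
    then show "tensor_lift f (s + t) = tensor_lift f s + tensor_lift f t"
      by (simp add: abs abs_tensor_linear(1)[symmetric] L)
  next
    fix c and t :: "('a, 'b) tensor"
    obtain p where "t = abs_tensor p" using tensor_exhaust by metis
    then show "tensor_lift f (c *\<^sub>C t) = c *\<^sub>C tensor_lift f t"
      by (simp add: abs abs_tensor_linear(2)[symmetric] L)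
  qed
  show "tensor_lift f (a \<otimes>\<^sub>C b) = f a b"
    by (simp add: tensor_prod.abs_eq abs formal_tensor_def linear_extension_single scaleC_one)
qed

lemma tensor_map_linear:
  assumes "clinear f" "clinear g"
  shows clinear_tensor_map: "clinear (tensor_map f g)"
    and tensor_map_tensor_prod: "tensor_map f g (a \<otimes>\<^sub>C b) = f a \<otimes>\<^sub>C g b"
proof -
  have left: "clinear (\<lambda>a. f a \<otimes>\<^sub>C g b)" for b
    by (rule clinearI) (simp_all add: tensor_prod_simps clinear_simps[OF assms(1)])
  have right: "clinear (\<lambda>b. f a \<otimes>\<^sub>C g b)" for a
    by (rule clinearI) (simp_all add: tensor_prod_simps clinear_simps[OF assms(2)])
  show "clinear (tensor_map f g)"
    unfolding tensor_map_def by (rule clinear_tensor_lift[OF left right])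
  show "tensor_map f g (a \<otimes>\<^sub>C b) = f a \<otimes>\<^sub>C g b"
    unfolding tensor_map_def by (rule tensor_lift_tensor_prod[OF left right])
qed

lemma clinear_id: "clinear id"
  by (rule clinearI) auto

lemma tensor_map_compose:
  assumes "clinear f" "clinear g" "clinear f'" "clinear g'"
    and "\<And>x. f' (f x) = h x" "\<And>x. g' (g x) = h' x" "clinear h" "clinear h'"
  shows "tensor_map f' g' (tensor_map f g t) = tensor_map h h' t"
proof (rule clinear_eq_tensor[where t = t])
  show "clinear (\<lambda>t. tensor_map f' g' (tensor_map f g t))"
    using clinear_compose[OF clinear_tensor_map[OF assms(1,2)] clinear_tensor_map[OF assms(3,4)]] .
  show "clinear (tensor_map h h')" by (rule clinear_tensor_map[OF assms(7,8)])
  show "tensor_map f' g' (tensor_map f g (a \<otimes>\<^sub>C b)) = tensor_map h h' (a \<otimes>\<^sub>C b)" for a b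
    using assms by (simp add: tensor_map_tensor_prod)
qed

lemma tensor_map_id: "tensor_map id id t = t"
  by (rule clinear_eq_tensor[where f = "tensor_map id id" and g = "\<lambda>x. x"])
    (simp_all add: clinear_tensor_map clinear_ident clinear_id tensor_map_tensor_prod)

section \<open>Exactness and gradings of the tensor product\<close>

text \<open>Over a field exactness survives tensoring because exact sequences split: one-sided inverses are
  preserved by the functor \<open>- \<otimes> S\<close>.\<close>

lemma inj_tensor_map_id:
  assumes "clinear i" "inj i" shows "inj (tensor_map i id)"
proof -
  obtain h where h: "clinear h" "h \<circ> i = id"
    using clinear_pair.linear_injective_left_inverse[OF assms] by blast
  have "tensor_map h id (tensor_map i id t) = tensor_map id id t" for t
    by (rule tensor_map_compose) (use h assms in \<open>simp_all add: clinear_id fun_eq_iff\<close>)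
  then show ?thesis by (metis injI tensor_map_id)
qed

lemma surj_tensor_map_id:
  assumes "clinear p" "surj p" shows "surj (tensor_map p id)"
proof -
  obtain q where q: "clinear q" "p \<circ> q = id"
    using clinear_pair.linear_surjective_right_inverse[OF assms] by blast
  have "tensor_map p id (tensor_map q id t) = tensor_map id id t" for t
    by (rule tensor_map_compose) (use q assms in \<open>simp_all add: clinear_id fun_eq_iff\<close>)
  then show ?thesis by (metis surjI tensor_map_id)
qed

text \<open>A section \<open>q\<close> of \<open>p\<close> and a retraction \<open>h\<close> of \<open>i\<close> decompose the identity as \<open>q p + i k\<close> with
  \<open>k = h (1 - q p)\<close>. After tensoring, the first summand is zero on the kernel of \<open>p \<otimes> 1\<close>.\<close>

lemma exact_tensor_map_id:
  assumes i: "clinear i" "inj i" and p: "clinear p" "surj p" and exact: "range i = {y. p y = 0}"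
  shows "range (tensor_map i id) = {t. tensor_map p id t = 0}"
proof (intro set_eqI iffI)
  fix t assume "t \<in> range (tensor_map i id)"
  then obtain s where s: "t = tensor_map i id s" by blast
  have pi: "p (i x) = 0" for x using exact by auto
  have "tensor_map p id t = 0"
    unfolding s
    by (rule clinear_eq_tensor[where t = s and g = "\<lambda>_. 0",
          OF clinear_compose[of "tensor_map i id" "tensor_map p id"]])
      (simp_all add: clinear_tensor_map clinear_id i p tensor_map_tensor_prod pi
        clinear_pair.linear_zero tensor_prod_scale_left[of 0, simplified])
  then show "t \<in> {t. tensor_map p id t = 0}" by simp
next
  fix t assume "t \<in> {t. tensor_map p id t = 0}"
  then have t: "tensor_map p id t = 0" by simp
  obtain h where h: "clinear h" "h \<circ> i = id"
    using clinear_pair.linear_injective_left_inverse[OF i] by blast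
  obtain q where q: "clinear q" "p \<circ> q = id"
    using clinear_pair.linear_surjective_right_inverse[OF p] by blast
  have split: "y = q (p y) + i (h (y - q (p y)))" for y
  proof -
    have "p (y - q (p y)) = 0"
      using q by (simp add: clinear_simps[OF p(1)] fun_eq_iff)
    then obtain x where x: "y - q (p y) = i x" using exact by blast
    have "h (i x) = x" using h(2) by (simp add: fun_eq_iff)
    then have "i (h (y - q (p y))) = y - q (p y)" by (simp add: x)
    then show ?thesis by simp
  qed
  let ?k = "\<lambda>y. h (y - q (p y))"
  have k: "clinear ?k"
    by (rule clinearI) (simp_all add: clinear_simps[OF h(1)] clinear_simps[OF q(1)] clinear_simps[OF p(1)]
        complex_vector.scale_right_diff_distrib algebra_simps)
  have "t = tensor_map q id (tensor_map p id t) + tensor_map i id (tensor_map ?k id t)"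
  proof (rule clinear_eq_tensor[where f = "\<lambda>t. t"])
    show "clinear (\<lambda>t. tensor_map q id (tensor_map p id t) + tensor_map i id (tensor_map ?k id t))"
      by (rule clinear_pair.linear_compose_add[OF
            clinear_compose[OF clinear_tensor_map[OF p(1) clinear_id] clinear_tensor_map[OF q(1) clinear_id]]
            clinear_compose[OF clinear_tensor_map[OF k clinear_id] clinear_tensor_map[OF i(1) clinear_id]]])
    show "a \<otimes>\<^sub>C b = tensor_map q id (tensor_map p id (a \<otimes>\<^sub>C b)) + tensor_map i id (tensor_map ?k id (a \<otimes>\<^sub>C b))" for a b
      using split[of a]
      by (simp add: tensor_map_tensor_prod clinear_id p q i k tensor_prod_add_left[symmetric])
  qed (rule clinear_ident)
  then have "t = tensor_map i id (tensor_map ?k id t)"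
    unfolding t clinear_pair.linear_0[OF clinear_tensor_map[OF q(1) clinear_id]] add_0_left .
  then show "t \<in> range (tensor_map i id)" by blast
qed

lemma tensor_map_tensor_part:
  assumes "clinear f" "clinear g" "g ` U \<subseteq> W" "t \<in> tensor_part U"
  shows "tensor_map f g t \<in> tensor_part W"
proof (rule clinear_image_span_subset[OF clinear_tensor_map[OF assms(1,2)] _ _ assms(4)[unfolded tensor_part_def]])
  show "csubspace (tensor_part W)" unfolding tensor_part_def by (rule complex_vector.subspace_span)
  show "tensor_map f g ` {v \<otimes>\<^sub>C m |v m. m \<in> U} \<subseteq> tensor_part W"
    using assms(3) unfolding tensor_part_def
    by (auto simp: tensor_map_tensor_prod assms(1,2) intro!: complex_vector.span_base) blast
qed

text \<open>The two parts meet only in \<open>0\<close> because the projection onto \<open>U\<close> along \<open>W\<close>, tensored with the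
  identity, is the identity on the first part and zero on the second.\<close>

lemma direct_sum_tensor_part:
  assumes "direct_sum UNIV U W"
  shows "direct_sum (UNIV :: ('v::complex_vector, 'm::complex_vector) tensor set) (tensor_part U) (tensor_part W)"
proof -
  have sub: "csubspace (tensor_part X)" for X :: "'m set"
    unfolding tensor_part_def by (rule complex_vector.subspace_span)
  obtain \<pi> where \<pi>: "clinear \<pi>" "\<And>u. u \<in> U \<Longrightarrow> \<pi> u = u" "\<And>w. w \<in> W \<Longrightarrow> \<pi> w = 0"
    using direct_sum_projection[OF assms] by metis
  have on_U: "tensor_map id \<pi> t = t" if "t \<in> tensor_part U" for t :: "('v, 'm) tensor"
    by (rule clinear_pair.linear_eq_on[OF clinear_tensor_map clinear_ident that[unfolded tensor_part_def]])
      (auto simp: clinear_id \<pi> tensor_map_tensor_prod)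
  have on_W: "tensor_map id \<pi> t = 0" if "t \<in> tensor_part W" for t :: "('v, 'm) tensor"
    by (rule clinear_pair.linear_eq_0_on_span[OF clinear_tensor_map _ that[unfolded tensor_part_def]])
      (auto simp: clinear_id \<pi> tensor_map_tensor_prod tensor_prod_scale_right[of _ 0, simplified])
  have "tensor_part U \<inter> tensor_part W \<subseteq> {0 :: ('v, 'm) tensor}"
    using on_U on_W by fastforce
  moreover have "t \<in> {u + w |u w. u \<in> tensor_part U \<and> w \<in> tensor_part W}" for t :: "('v, 'm) tensor"
  proof -
    let ?S = "{u + w |u w. u \<in> tensor_part U \<and> w \<in> tensor_part W} :: ('v, 'm) tensor set"
    have "a \<otimes>\<^sub>C b \<in> ?S" for a b
    proof -
      obtain u w where "u \<in> U" "w \<in> W" "b = u + w" using direct_sum_decompose[OF assms] by blast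
      then show ?thesis
        by (auto simp: tensor_prod_add_right tensor_part_def intro!: exI complex_vector.span_base)
    qed
    then have "{a \<otimes>\<^sub>C b | a b. True} \<subseteq> ?S" by blast
    from complex_vector.span_minimal[OF this complex_vector.subspace_sums[OF sub sub]]
    show ?thesis using cspan_tensor_prod by blast
  qed
  ultimately show ?thesis
    using complex_vector.subspace_0[OF sub] by (auto simp: direct_sum_def sub)
qed

section \<open>The Dirac operator on the tensor product with the spin module\<close>

lemma free_algebra_act_eq:
  "free_algebra_act a p v = linear_extension (\<lambda>w. foldr a (letters w) v) p"
  by (simp add: free_algebra_act_def linear_extension_def)

lemma clinear_foldr:
  assumes "\<And>x. clinear (a x)" shows "clinear (\<lambda>v. foldr a xs v)"
  by (induction xs) (auto intro: clinear_ident clinear_compose assms)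

lemma clinear_free_algebra_act:
  assumes "\<And>x. clinear (a x)" shows "clinear (free_algebra_act a p)"
  unfolding free_algebra_act_def
  by (intro clinear_sum_scale clinear_foldr assms)

lemma clinear_free_algebra_act_left: "clinear (\<lambda>p. free_algebra_act a p v)"
  unfolding free_algebra_act_eq by (rule clinear_linear_extension)

lemma free_algebra_act_mult:
  assumes "\<And>x. clinear (a x)"
  shows "free_algebra_act a (p * q) v = free_algebra_act a p (free_algebra_act a q v)"
proof -
  note act = clinear_free_algebra_act_left[of a]
  show ?thesis
  proof (rule clinear_eq_poly_mapping[where p = p])
    show "clinear (\<lambda>p. free_algebra_act a (p * q) v)"
      by (rule clinear_compose[OF _ act]) (rule clinearI; simp add: distrib_right scaleC_conv_mult mult.assoc)
    show "clinear (\<lambda>p. free_algebra_act a p (free_algebra_act a q v))" by (rule act)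
    fix u
    show "free_algebra_act a (Poly_Mapping.single u 1 * q) v
        = free_algebra_act a (Poly_Mapping.single u 1) (free_algebra_act a q v)"
    proof (rule clinear_eq_poly_mapping[where p = q])
      show "clinear (\<lambda>q. free_algebra_act a (Poly_Mapping.single u 1 * q) v)"
        by (rule clinear_compose[OF _ act])
          (rule clinearI; simp add: distrib_left scaleC_conv_mult_right mult.assoc)
      show "clinear (\<lambda>q. free_algebra_act a (Poly_Mapping.single u 1) (free_algebra_act a q v))"
        by (rule clinear_compose[OF act clinear_free_algebra_act[OF assms]])
      show "free_algebra_act a (Poly_Mapping.single u 1 * Poly_Mapping.single k 1) v
          = free_algebra_act a (Poly_Mapping.single u 1) (free_algebra_act a (Poly_Mapping.single k 1) v)" for k
        by (simp add: mult_single free_algebra_act_eq linear_extension_single plus_word_def scaleC_one)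
    qed
  qed
qed

text \<open>Words act by composition, so the action is multiplicative and it suffices that the defining relations
  of the enveloping algebra act as zero, which is what it means to be a representation.\<close>

lemma free_algebra_act_uea_ideal:
  assumes "lie_rep a" "z \<in> two_sided_ideal uea_relations"
  shows "free_algebra_act a z v = 0"
proof -
  have lin: "clinear (a x)" "clinear (\<lambda>x. a x u)" and br: "a \<lbrakk>x, y\<rbrakk>\<^sub>L u = a x (a y u) - a y (a x u)" for x y u
    using assms(1) by (auto simp: lie_rep_def)
  note act = clinear_free_algebra_act_left[of a]
  note L = clinear_simps[OF act]
  have gen: "free_algebra_act a (gen x) u = a x u" for x u
    by (simp add: free_algebra_act_eq gen_def linear_extension_single scaleC_one)
  note mult = free_algebra_act_mult[of a, OF lin(1)]
  have rel: "free_algebra_act a r u = 0" if "r \<in> uea_relations" for r u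
    using that
  proof cases
    case 1
    then show ?thesis
      by cases (simp_all add: L gen clinear_simps[OF lin(2)])
  next
    case (2 x y)
    then show ?thesis by (simp add: L gen mult br)
  qed
  show ?thesis
    using assms(2)
    by (induction rule: two_sided_ideal.induct)
      (simp_all add: L mult rel clinear_simps[OF clinear_free_algebra_act[OF lin(1)]])
qed

lemma uea_act_abs:
  assumes "lie_rep a" shows "uea_act a (abs_uea p) v = free_algebra_act a p v"
proof -
  have "uea_equiv (rep_uea (abs_uea p)) p"
    using Quotient_abs_rep[OF Quotient_uea] by (simp only: uea.abs_eq_iff[symmetric])
  then have "free_algebra_act a (rep_uea (abs_uea p) - p) v = 0"
    using free_algebra_act_uea_ideal[OF assms] by (simp add: uea_equiv_def)
  then show ?thesis
    by (simp add: uea_act_def free_algebra_act_eq clinear_simps[OF clinear_linear_extension])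
qed

lemma clinear_uea_act_left:
  assumes "lie_rep a" shows "clinear (\<lambda>u. uea_act a u v)"
proof (rule clinearI)
  have ex: "\<exists>p. u = abs_uea p" for u :: "'a uea" by (metis Quotient_abs_rep Quotient_uea)
  note L = clinear_simps[OF clinear_linear_extension]
  show "uea_act a (x + y) v = uea_act a x v + uea_act a y v" for x y
  proof -
    obtain p q where "x = abs_uea p" "y = abs_uea q" using ex by metis
    then show ?thesis
      by (simp add: plus_uea.abs_eq uea_act_abs[OF assms] free_algebra_act_eq L)
  qed
  show "uea_act a (c *\<^sub>C x) v = c *\<^sub>C uea_act a x v" for c x
  proof -
    obtain p where "x = abs_uea p" using ex by metis
    then show ?thesis
      by (simp add: scaleC_uea.abs_eq uea_act_abs[OF assms] free_algebra_act_eq L)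
  qed
qed

lemma clinear_uea_act:
  assumes "lie_rep a" shows "clinear (uea_act a u)"
  using clinear_free_algebra_act[of a] assms by (simp add: uea_act_def lie_rep_def)

lemma clinear_tensor_act:
  assumes "\<And>a. clinear (\<rho> a)" "\<And>c. clinear (\<sigma> c)"
  shows "clinear (tensor_act \<rho> \<sigma> t)"
  unfolding tensor_act_def tensor_lift_def Let_def
  by (intro clinear_sum_scale clinear_tensor_map assms)

text \<open>Both sides are evaluated on the same representative of \<open>t\<close>, so the identity holds term by term.\<close>

lemma tensor_map_tensor_act:
  assumes f: "clinear f" and \<rho>: "\<And>a. clinear (\<rho> a)" "\<And>a. clinear (\<rho>' a)" and \<sigma>: "\<And>c. clinear (\<sigma> c)"
    and comm: "\<And>a v. f (\<rho> a v) = \<rho>' a (f v)"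
  shows "tensor_map f id (tensor_act \<rho> \<sigma> t w) = tensor_act \<rho>' \<sigma> t (tensor_map f id w)"
proof -
  note F = clinear_tensor_map[OF f clinear_id]
  have "tensor_map f id (tensor_map (\<rho> a) (\<sigma> c) w) = tensor_map (\<rho>' a) (\<sigma> c) (tensor_map f id w)" for a c
    by (simp add: tensor_map_compose[where h = "\<lambda>v. \<rho>' a (f v)" and h' = "\<sigma> c"] assms clinear_id clinear_compose)
  then show ?thesis
    unfolding tensor_act_def tensor_lift_def Let_def
    by (simp add: clinear_pair.linear_sum[OF F] clinear_simps[OF F])
qed

lemma uea_act_intertwines:
  assumes "clinear f" "\<And>x v. f (a x v) = b x (f v)"
  shows "f (uea_act a u v) = uea_act b u (f v)"
proof -
  have "f (foldr a xs v) = foldr b xs (f v)" for xs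
    by (induction xs) (simp_all add: assms(2))
  then show ?thesis
    by (simp add: uea_act_def free_algebra_act_def clinear_pair.linear_sum[OF assms(1)] clinear_simps[OF assms(1)])
qed

text \<open>For a fixed vector \<open>w\<close>, the operator by which \<open>a \<otimes> c\<close> acts depends bilinearly on \<open>a\<close> and \<open>c\<close>. Hence
  the action can be evaluated on an explicit sum of pure tensors such as the cubic Dirac element.\<close>

lemma tensor_act_bilinear:
  assumes \<rho>: "\<And>a. clinear (\<rho> a)" "\<And>v. clinear (\<lambda>a. \<rho> a v)"
    and \<sigma>: "\<And>c. clinear (\<sigma> c)" "\<And>m. clinear (\<lambda>c. \<sigma> c m)"
  shows clinear_tensor_act_left: "clinear (\<lambda>t. tensor_act \<rho> \<sigma> t w)"
    and tensor_act_tensor_prod: "tensor_act \<rho> \<sigma> (a \<otimes>\<^sub>C c) w = tensor_map (\<rho> a) (\<sigma> c) w"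
proof -
  note lin = clinear_tensor_map[OF \<rho>(1) \<sigma>(1)]
  note prod = tensor_map_tensor_prod[OF \<rho>(1) \<sigma>(1)]
  have 1: "clinear (\<lambda>a. tensor_map (\<rho> a) (\<sigma> c) w)" for c
  proof (rule clinearI)
    fix x y and d :: complex
    show "tensor_map (\<rho> (x + y)) (\<sigma> c) w = tensor_map (\<rho> x) (\<sigma> c) w + tensor_map (\<rho> y) (\<sigma> c) w"
      by (rule clinear_eq_tensor[where t = w], (intro lin clinear_pair.linear_compose_add)+)
        (unfold prod, simp only: clinear_simps[OF \<rho>(2)] tensor_prod_simps)
    show "tensor_map (\<rho> (d *\<^sub>C x)) (\<sigma> c) w = d *\<^sub>C tensor_map (\<rho> x) (\<sigma> c) w"
      by (rule clinear_eq_tensor[where t = w], (intro lin clinear_pair.linear_compose_scale_right)+)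
        (unfold prod, simp only: clinear_simps[OF \<rho>(2)] tensor_prod_simps)
  qed
  have 2: "clinear (\<lambda>c. tensor_map (\<rho> a) (\<sigma> c) w)" for a
  proof (rule clinearI)
    fix x y and d :: complex
    show "tensor_map (\<rho> a) (\<sigma> (x + y)) w = tensor_map (\<rho> a) (\<sigma> x) w + tensor_map (\<rho> a) (\<sigma> y) w"
      by (rule clinear_eq_tensor[where t = w], (intro lin clinear_pair.linear_compose_add)+)
        (unfold prod, simp only: clinear_simps[OF \<sigma>(2)] tensor_prod_simps)
    show "tensor_map (\<rho> a) (\<sigma> (d *\<^sub>C x)) w = d *\<^sub>C tensor_map (\<rho> a) (\<sigma> x) w"
      by (rule clinear_eq_tensor[where t = w], (intro lin clinear_pair.linear_compose_scale_right)+)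
        (unfold prod, simp only: clinear_simps[OF \<sigma>(2)] tensor_prod_simps)
  qed
  show "clinear (\<lambda>t. tensor_act \<rho> \<sigma> t w)"
    unfolding tensor_act_def by (rule clinear_tensor_lift[OF 1 2])
  show "tensor_act \<rho> \<sigma> (a \<otimes>\<^sub>C c) w = tensor_map (\<rho> a) (\<sigma> c) w"
    unfolding tensor_act_def by (rule tensor_lift_tensor_prod[OF 1 2])
qed

text \<open>Each summand of the cubic Dirac element has one or three vectors of \<open>s\<close> in its Clifford factor, and
  a product of an odd number of vectors reverses parity.\<close>

lemma odd_operator_dirac_operator:
  fixes act :: "'g::complex_lie_algebra \<Rightarrow> 'v::complex_vector \<Rightarrow> 'v"
    and \<sigma> :: "'s::complex_quadratic_space clifford \<Rightarrow> 'm::complex_vector \<Rightarrow> 'm"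
  assumes act: "lie_rep act" and \<sigma>: "algebra_module \<sigma>" and P: "spin_grading \<sigma> P"
  shows "odd_operator (dirac_operator e Z n act \<sigma>) (\<lambda>\<epsilon>. tensor_part (P \<epsilon>))"
proof (rule odd_operator.intro)
  have \<sigma>_lin: "\<And>c. clinear (\<sigma> c)" "\<And>m. clinear (\<lambda>c. \<sigma> c m)" and \<sigma>_mult: "\<And>a b m. \<sigma> (a * b) m = \<sigma> a (\<sigma> b m)"
    using \<sigma> by (auto simp: algebra_module_def)
  have grading: "direct_sum UNIV (P 0) (P 1)" and odd: "\<And>v m \<epsilon>. m \<in> P \<epsilon> \<Longrightarrow> \<sigma> (clifford_gen v) m \<in> P (\<epsilon> + 1)"
    using P by (auto simp: spin_grading_def)
  note act_lin = clinear_uea_act[OF act] clinear_uea_act_left[OF act]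
  note bilinear = tensor_act_bilinear[of "uea_act act" \<sigma>, OF act_lin \<sigma>_lin]
  show "clinear (dirac_operator e Z n act \<sigma>)"
    unfolding dirac_operator_def by (rule clinear_tensor_act[OF act_lin(1) \<sigma>_lin(1)])
  show "direct_sum (UNIV :: ('v, 'm) tensor set) (tensor_part (P 0)) (tensor_part (P 1))"
    by (rule direct_sum_tensor_part[OF grading])
  fix w :: "('v, 'm) tensor" and \<epsilon> assume w: "w \<in> tensor_part (P \<epsilon>)"
  have sub: "csubspace (tensor_part (P (\<epsilon> + 1)) :: ('v, 'm) tensor set)"
    unfolding tensor_part_def by (rule complex_vector.subspace_span)
  have summand: "tensor_act (uea_act act) \<sigma> (u \<otimes>\<^sub>C c) w \<in> tensor_part (P (\<epsilon> + 1))"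
    if "\<And>m. m \<in> P \<epsilon> \<Longrightarrow> \<sigma> c m \<in> P (\<epsilon> + 1)" for u c
    unfolding bilinear(2) using that
    by (intro tensor_map_tensor_part[OF act_lin(1) \<sigma>_lin(1) _ w]) auto
  have cubic: "\<sigma> (clifford_gen x * clifford_gen y * clifford_gen z) m \<in> P (\<epsilon> + 1)" if "m \<in> P \<epsilon>" for x y z m
    using odd[OF odd[OF odd[OF that]], of x y z] by (simp only: bit_add_one_one \<sigma>_mult)
  show "dirac_operator e Z n act \<sigma> w \<in> tensor_part (P (\<epsilon> + 1))"
    unfolding dirac_operator_def cubic_dirac_def
      clinear_simps[OF bilinear(1)] clinear_pair.linear_sum[OF bilinear(1)]
    by (intro complex_vector.subspace_diff[OF sub] complex_vector.subspace_scale[OF sub]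
        complex_vector.subspace_sum[OF sub] summand cubic odd)
qed

lemma dirac_operator_natural:
  assumes act: "lie_rep act" "lie_rep act'" and \<sigma>: "algebra_module \<sigma>"
    and f: "clinear f" "\<And>x v. f (act x v) = act' x (f v)"
  shows "tensor_map f id (dirac_operator e Z n act \<sigma> w) = dirac_operator e Z n act' \<sigma> (tensor_map f id w)"
  unfolding dirac_operator_def
  by (rule tensor_map_tensor_act)
    (use \<sigma> in \<open>auto simp: algebra_module_def f clinear_uea_act act uea_act_intertwines[OF f(1)]\<close>)

section \<open>The six-term exact sequence\<close>

theorem theorem8p1:
  fixes \<A> :: "('G::{topological_group_add, t2_space, second_countable_topology}, 'e::real_normed_vector) chart set"
    and K :: "'G set"
    and \<phi> :: "'G field \<Rightarrow> 'g::complex_lie_algebra"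
    and r s :: "'g set"
    and e :: "'s::complex_quadratic_space \<Rightarrow> 'g"
    and Z :: "nat \<Rightarrow> 's" and n :: nat
    and \<sigma> :: "'s clifford \<Rightarrow> 'm::complex_vector \<Rightarrow> 'm"
    and P :: "bit \<Rightarrow> 'm set"
    and act\<^sub>X :: "'g \<Rightarrow> 'x::complex_vector \<Rightarrow> 'x" and kact\<^sub>X :: "'G \<Rightarrow> 'x \<Rightarrow> 'x"
    and act\<^sub>Y :: "'g \<Rightarrow> 'y::complex_vector \<Rightarrow> 'y" and kact\<^sub>Y :: "'G \<Rightarrow> 'y \<Rightarrow> 'y"
    and act\<^sub>Z :: "'g \<Rightarrow> 'z::complex_vector \<Rightarrow> 'z" and kact\<^sub>Z :: "'G \<Rightarrow> 'z \<Rightarrow> 'z"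
    and i :: "'x \<Rightarrow> 'y" and p :: "'y \<Rightarrow> 'z"
    and D\<^sub>X :: "('x, 'm) tensor \<Rightarrow> ('x, 'm) tensor" and D\<^sub>Y :: "('y, 'm) tensor \<Rightarrow> ('y, 'm) tensor"
    and D\<^sub>Z :: "('z, 'm) tensor \<Rightarrow> ('z, 'm) tensor"
    and E\<^sub>X :: "bit \<Rightarrow> ('x, 'm) tensor set" and E\<^sub>Y :: "bit \<Rightarrow> ('y, 'm) tensor set"
    and E\<^sub>Z :: "bit \<Rightarrow> ('z, 'm) tensor set"
    and H\<^sub>X :: "bit \<Rightarrow> ('x, 'm) tensor set set" and H\<^sub>Y :: "bit \<Rightarrow> ('y, 'm) tensor set set"
    and H\<^sub>Z :: "bit \<Rightarrow> ('z, 'm) tensor set set"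
    and i\<^sub>S :: "('x, 'm) tensor \<Rightarrow> ('y, 'm) tensor" and p\<^sub>S :: "('y, 'm) tensor \<Rightarrow> ('z, 'm) tensor"
    and i\<^sub>H :: "('x, 'm) tensor set \<Rightarrow> ('y, 'm) tensor set" and p\<^sub>H :: "('y, 'm) tensor set \<Rightarrow> ('z, 'm) tensor set"
  assumes "semisimple_lie_group \<A>" and "connected (UNIV :: 'G set)" and "finite (group_center :: 'G set)"
    and "maximal_compact_subgroup K"
    and "complexified_lie_algebra \<A> \<phi>"
    and "reductive_subalgebra r" and "nondegenerate_on r" and "orthogonal_decomposition r s"
    and "even (cdim s)" and "isometric_onto e s" and "orthonormal_basis Z n"
    and "simple_module \<sigma>" and "spin_grading \<sigma> P"
    and "gK_module \<A> K \<phi> act\<^sub>X kact\<^sub>X" and "gK_module \<A> K \<phi> act\<^sub>Y kact\<^sub>Y" and "gK_module \<A> K \<phi> act\<^sub>Z kact\<^sub>Z"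
    and "gK_hom K act\<^sub>X kact\<^sub>X act\<^sub>Y kact\<^sub>Y i" and "gK_hom K act\<^sub>Y kact\<^sub>Y act\<^sub>Z kact\<^sub>Z p"
    and "inj i" and "range i = {y. p y = 0}" and "surj p"
    and "D\<^sub>X = dirac_operator e Z n act\<^sub>X \<sigma>"
    and "D\<^sub>Y = dirac_operator e Z n act\<^sub>Y \<sigma>"
    and "D\<^sub>Z = dirac_operator e Z n act\<^sub>Z \<sigma>"
    and "diagonalizable (D\<^sub>X \<circ> D\<^sub>X)" and "diagonalizable (D\<^sub>Y \<circ> D\<^sub>Y)" and "diagonalizable (D\<^sub>Z \<circ> D\<^sub>Z)"
    and "\<And>\<epsilon>. E\<^sub>X \<epsilon> = tensor_part (P \<epsilon>)"
    and "\<And>\<epsilon>. E\<^sub>Y \<epsilon> = tensor_part (P \<epsilon>)"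
    and "\<And>\<epsilon>. E\<^sub>Z \<epsilon> = tensor_part (P \<epsilon>)"
    and "\<And>\<epsilon>. H\<^sub>X \<epsilon> = graded_dirac_cohomology (E\<^sub>X \<epsilon>) D\<^sub>X"
    and "\<And>\<epsilon>. H\<^sub>Y \<epsilon> = graded_dirac_cohomology (E\<^sub>Y \<epsilon>) D\<^sub>Y"
    and "\<And>\<epsilon>. H\<^sub>Z \<epsilon> = graded_dirac_cohomology (E\<^sub>Z \<epsilon>) D\<^sub>Z"
    and "i\<^sub>S = tensor_map i id" and "p\<^sub>S = tensor_map p id"
    and "i\<^sub>H = induced_map D\<^sub>Y i\<^sub>S" and "p\<^sub>H = induced_map D\<^sub>Z p\<^sub>S"
  shows "\<exists>\<delta> :: bit \<Rightarrow> ('z, 'm) tensor set \<Rightarrow> ('x, 'm) tensor set.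
    (\<forall>\<epsilon>. connecting_map D\<^sub>X D\<^sub>Y D\<^sub>Z E\<^sub>X E\<^sub>Y E\<^sub>Z i\<^sub>S p\<^sub>S \<epsilon> (\<delta> \<epsilon>)) \<and>
    (\<forall>\<epsilon>. cohomology_hom D\<^sub>X D\<^sub>Y (H\<^sub>X \<epsilon>) (H\<^sub>Y \<epsilon>) i\<^sub>H \<and>
         cohomology_hom D\<^sub>Y D\<^sub>Z (H\<^sub>Y \<epsilon>) (H\<^sub>Z \<epsilon>) p\<^sub>H \<and>
         cohomology_hom D\<^sub>Z D\<^sub>X (H\<^sub>Z \<epsilon>) (H\<^sub>X (\<epsilon> + 1)) (\<delta> \<epsilon>)) \<and>
    exact_at D\<^sub>Z (H\<^sub>X 0) (H\<^sub>Y 0) i\<^sub>H p\<^sub>H \<and>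
    exact_at D\<^sub>X (H\<^sub>Y 0) (H\<^sub>Z 0) p\<^sub>H (\<delta> 0) \<and>
    exact_at D\<^sub>Y (H\<^sub>Z 0) (H\<^sub>X 1) (\<delta> 0) i\<^sub>H \<and>
    exact_at D\<^sub>Z (H\<^sub>X 1) (H\<^sub>Y 1) i\<^sub>H p\<^sub>H \<and>
    exact_at D\<^sub>X (H\<^sub>Y 1) (H\<^sub>Z 1) p\<^sub>H (\<delta> 1) \<and>
    exact_at D\<^sub>Y (H\<^sub>Z 1) (H\<^sub>X 0) (\<delta> 1) i\<^sub>H"
proof -
  have rep: "lie_rep act\<^sub>X" "lie_rep act\<^sub>Y" "lie_rep act\<^sub>Z"
    using assms(14-16) by (simp_all add: gK_module_def)
  have i: "clinear i" "\<And>x v. i (act\<^sub>X x v) = act\<^sub>Y x (i v)"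
    and p: "clinear p" "\<And>x v. p (act\<^sub>Y x v) = act\<^sub>Z x (p v)"
    using assms(17,18) by (auto simp: gK_hom_def)
  have \<sigma>: "algebra_module \<sigma>" using assms(12) by (simp add: simple_module_def)
  note P = assms(13) and inj_i = assms(19) and exact = assms(20) and surj_p = assms(21)
  note D_defs = assms(22-24) and diag = assms(25-27) and E_defs = assms(28-30) and H_defs = assms(31-33)
  note map_defs = assms(34,35) and induced_defs = assms(36,37)
  have E_eq: "E\<^sub>X = (\<lambda>\<epsilon>. tensor_part (P \<epsilon>))" "E\<^sub>Y = (\<lambda>\<epsilon>. tensor_part (P \<epsilon>))"
    "E\<^sub>Z = (\<lambda>\<epsilon>. tensor_part (P \<epsilon>))"
    by (simp_all add: fun_eq_iff E_defs)
  have odd_X: "odd_operator D\<^sub>X E\<^sub>X" and odd_Y: "odd_operator D\<^sub>Y E\<^sub>Y" and odd_Z: "odd_operator D\<^sub>Z E\<^sub>Z"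
    unfolding D_defs E_eq by (rule odd_operator_dirac_operator[OF _ \<sigma> P], rule rep)+
  note linear = odd_X[THEN odd_operator.linear] odd_Y[THEN odd_operator.linear] odd_Z[THEN odd_operator.linear]
  have i_D: "i\<^sub>S (D\<^sub>X t) = D\<^sub>Y (i\<^sub>S t)" for t
    unfolding map_defs D_defs using dirac_operator_natural[OF rep(1,2) \<sigma> i(1)] i(2) by blast
  have p_D: "p\<^sub>S (D\<^sub>Y t) = D\<^sub>Z (p\<^sub>S t)" for t
    unfolding map_defs D_defs using dirac_operator_natural[OF rep(2,3) \<sigma> p(1)] p(2) by blast
  have lin_maps: "clinear i\<^sub>S" "clinear p\<^sub>S"
    unfolding map_defs by (intro clinear_tensor_map i p clinear_id)+
  interpret odd_exact_sequence D\<^sub>X E\<^sub>X D\<^sub>Y E\<^sub>Y D\<^sub>Z E\<^sub>Z i\<^sub>S p\<^sub>S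
  proof (intro odd_exact_sequence.intro odd_exact_sequence_axioms.intro odd_X odd_Y odd_Z lin_maps i_D p_D)
    show "i\<^sub>S t \<in> E\<^sub>Y \<epsilon>" if "t \<in> E\<^sub>X \<epsilon>" for t \<epsilon>
      using that unfolding E_eq map_defs by (intro tensor_map_tensor_part[OF i(1) clinear_id]) auto
    show "p\<^sub>S t \<in> E\<^sub>Z \<epsilon>" if "t \<in> E\<^sub>Y \<epsilon>" for t \<epsilon>
      using that unfolding E_eq map_defs by (intro tensor_map_tensor_part[OF p(1) clinear_id]) auto
    show "inj i\<^sub>S" unfolding map_defs by (rule inj_tensor_map_id[OF i(1) inj_i])
    show "range i\<^sub>S = {t. p\<^sub>S t = 0}"
      unfolding map_defs by (rule exact_tensor_map_id[OF i(1) inj_i p(1) surj_p exact])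
    have "surj p\<^sub>S" unfolding map_defs by (rule surj_tensor_map_id[OF p(1) surj_p])
    moreover have "clinear (D\<^sub>Y \<circ> D\<^sub>Y)" "clinear (D\<^sub>Z \<circ> D\<^sub>Z)"
      using clinear_compose[OF linear(2) linear(2)] clinear_compose[OF linear(3) linear(3)]
      by (simp_all add: comp_def)
    ultimately show "\<exists>t. D\<^sub>Y (D\<^sub>Y t) = 0 \<and> p\<^sub>S t = z" if "D\<^sub>Z (D\<^sub>Z z) = 0" for z
      using kernel_lift_of_diagonalizable[OF lin_maps(2), of "D\<^sub>Y \<circ> D\<^sub>Y" "D\<^sub>Z \<circ> D\<^sub>Z" z] diag(2,3) that p_D
      by simp
  qed
  have H_eq: "H\<^sub>X \<epsilon> = homogeneous_classes (E\<^sub>X \<epsilon>) D\<^sub>X" "H\<^sub>Y \<epsilon> = homogeneous_classes (E\<^sub>Y \<epsilon>) D\<^sub>Y"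
    "H\<^sub>Z \<epsilon> = homogeneous_classes (E\<^sub>Z \<epsilon>) D\<^sub>Z" for \<epsilon>
    by (simp_all only: H_defs graded_dirac_cohomology_eq linear)
  show ?thesis
    unfolding H_eq induced_defs
    using connecting_map_connecting cohomology_hom_i cohomology_hom_p cohomology_hom_connecting
      exact_at_Y exact_at_Z exact_at_X[of 0] exact_at_X[of 1]
    by (intro exI[of _ "\<lambda>_. connecting"]) simp
qed

end
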